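(* Let $B$ be an initial object, and suppose that no quotient of $B$ has a minimal non-zero projection. Then the trace simplex $T(B)$ of $B$ is necessarily infinite-dimensional.
   Context: A unital C$^*$-algebra is called an initial object if it embeds unitally (by an injective unital $^*$-homomorphism) into every unital C$^*$-algebra of real rank zero which has no non-zero finite-dimensional representations. $T(B)$ denotes the simplex of tracial states of $B$. A minimal non-zero projection is a non-zero projection which has no non-zero proper subprojection. Unital C$^*$-algebras are understood to be non-zero. *)

theory Defs
  imports
    "HOL-Algebra.QuotRing"
    "HOL-Algebra.Module"
    "Jordan_Normal_Form.Missing_Ring"
    "Jordan_Normal_Form.Schur_Decomposition"
begin

section \<open>Unital C*-algebras\<close>

text \<open>
  Algebras are carrier-based, so that one can quantify over all C*-algebras on a given type and
  form quotients. \<^const>\<open>class_ring\<close> is the field of complex numbers here.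
\<close>

record 'a star_algebra = "(complex, 'a) module" +
  star :: "'a \<Rightarrow> 'a"

record 'a cstar_algebra = "'a star_algebra" +
  alg_norm :: "'a \<Rightarrow> real"

definition norm_complete :: "('a, 'm) cstar_algebra_scheme \<Rightarrow> bool" where
  "norm_complete A \<longleftrightarrow>
    (\<forall>X :: nat \<Rightarrow> 'a. range X \<subseteq> carrier A \<longrightarrow>
      (\<forall>e>0. \<exists>N. \<forall>m\<ge>N. \<forall>n\<ge>N. alg_norm A (X m \<ominus>\<^bsub>A\<^esub> X n) < e) \<longrightarrow>
      (\<exists>x\<in>carrier A. (\<lambda>n. alg_norm A (X n \<ominus>\<^bsub>A\<^esub> x)) \<longlonglongrightarrow> 0))"

locale unital_cstar_algebra =
  ring A + Module.module "class_ring :: complex ring" A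
  for A :: "('a, 'm) cstar_algebra_scheme" (structure) +
  assumes one_neq_zero: "\<one> \<noteq> \<zero>"
    and smult_mult_left:
      "\<lbrakk>x \<in> carrier A; y \<in> carrier A\<rbrakk> \<Longrightarrow> (c \<odot> x) \<otimes> y = c \<odot> (x \<otimes> y)"
    and smult_mult_right:
      "\<lbrakk>x \<in> carrier A; y \<in> carrier A\<rbrakk> \<Longrightarrow> x \<otimes> (c \<odot> y) = c \<odot> (x \<otimes> y)"
    and star_closed: "x \<in> carrier A \<Longrightarrow> star A x \<in> carrier A"
    and star_star: "x \<in> carrier A \<Longrightarrow> star A (star A x) = x"
    and star_add:
      "\<lbrakk>x \<in> carrier A; y \<in> carrier A\<rbrakk> \<Longrightarrow> star A (x \<oplus> y) = star A x \<oplus> star A y"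
    and star_smult: "x \<in> carrier A \<Longrightarrow> star A (c \<odot> x) = cnj c \<odot> star A x"
    and star_mult:
      "\<lbrakk>x \<in> carrier A; y \<in> carrier A\<rbrakk> \<Longrightarrow> star A (x \<otimes> y) = star A y \<otimes> star A x"
    and norm_nonneg: "x \<in> carrier A \<Longrightarrow> 0 \<le> alg_norm A x"
    and norm_eq_zero_iff: "x \<in> carrier A \<Longrightarrow> alg_norm A x = 0 \<longleftrightarrow> x = \<zero>"
    and norm_smult: "x \<in> carrier A \<Longrightarrow> alg_norm A (c \<odot> x) = cmod c * alg_norm A x"
    and norm_triangle:
      "\<lbrakk>x \<in> carrier A; y \<in> carrier A\<rbrakk> \<Longrightarrow> alg_norm A (x \<oplus> y) \<le> alg_norm A x + alg_norm A y"
    and norm_mult_le: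
      "\<lbrakk>x \<in> carrier A; y \<in> carrier A\<rbrakk> \<Longrightarrow> alg_norm A (x \<otimes> y) \<le> alg_norm A x * alg_norm A y"
    and norm_cstar: "x \<in> carrier A \<Longrightarrow> alg_norm A (star A x \<otimes> x) = (alg_norm A x)\<^sup>2"
    and complete: "norm_complete A"

section \<open>Homomorphisms and finite-dimensional representations\<close>

definition star_hom ::
    "('a, 'm) star_algebra_scheme \<Rightarrow> ('b, 'n) star_algebra_scheme \<Rightarrow> ('a \<Rightarrow> 'b) set" where
  "star_hom A B = {h \<in> carrier A \<rightarrow> carrier B.
     (\<forall>x\<in>carrier A. \<forall>y\<in>carrier A. h (x \<oplus>\<^bsub>A\<^esub> y) = h x \<oplus>\<^bsub>B\<^esub> h y) \<and>
     (\<forall>x\<in>carrier A. \<forall>y\<in>carrier A. h (x \<otimes>\<^bsub>A\<^esub> y) = h x \<otimes>\<^bsub>B\<^esub> h y) \<and>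
     (\<forall>c. \<forall>x\<in>carrier A. h (c \<odot>\<^bsub>A\<^esub> x) = c \<odot>\<^bsub>B\<^esub> h x) \<and>
     (\<forall>x\<in>carrier A. h (star A x) = star B (h x))}"

definition embeds_unitally ::
    "('a, 'm) star_algebra_scheme \<Rightarrow> ('b, 'n) star_algebra_scheme \<Rightarrow> bool" where
  "embeds_unitally A B \<longleftrightarrow>
    (\<exists>h \<in> star_hom A B. h \<one>\<^bsub>A\<^esub> = \<one>\<^bsub>B\<^esub> \<and> inj_on h (carrier A))"

definition mat_star_algebra :: "nat \<Rightarrow> complex mat star_algebra" where
  "mat_star_algebra n =
     \<lparr>carrier = carrier_mat n n, monoid.mult = (*), one = 1\<^sub>m n, zero = 0\<^sub>m n n, add = (+),
      module.smult = (\<cdot>\<^sub>m), star = mat_adjoint\<rparr>"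

text \<open>
  Representations on the Hilbert space of \<open>n\<close>-tuples of complex numbers; they are not required
  to be unital, only not to vanish identically.
\<close>

definition has_nonzero_findim_rep :: "('a, 'm) star_algebra_scheme \<Rightarrow> bool" where
  "has_nonzero_findim_rep A \<longleftrightarrow>
    (\<exists>n. \<exists>h \<in> star_hom A (mat_star_algebra n). \<exists>x\<in>carrier A. h x \<noteq> 0\<^sub>m n n)"

section \<open>Real rank zero and initial objects\<close>

definition self_adjoint :: "('a, 'm) star_algebra_scheme \<Rightarrow> 'a \<Rightarrow> bool" where
  "self_adjoint A x \<longleftrightarrow> x \<in> carrier A \<and> star A x = x"

text \<open>The definition of Brown and Pedersen: invertible self-adjoint elements are dense in the
  self-adjoint elements.\<close>

definition real_rank_zero :: "('a, 'm) cstar_algebra_scheme \<Rightarrow> bool" where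
  "real_rank_zero A \<longleftrightarrow>
    (\<forall>x. self_adjoint A x \<longrightarrow>
      (\<forall>e>0. \<exists>y. self_adjoint A y \<and> y \<in> Units A \<and> alg_norm A (x \<ominus>\<^bsub>A\<^esub> y) < e))"

text \<open>
  HOL cannot quantify over all types inside a formula, so the notion is relative to a type
  \<open>'u\<close> which serves as the universe of the target algebras. Being initial relative to a given
  universe is implied by being initial in the absolute sense.
\<close>

definition initial_object :: "'u itself \<Rightarrow> ('a, 'm) cstar_algebra_scheme \<Rightarrow> bool" where
  "initial_object U B \<longleftrightarrow> unital_cstar_algebra B \<and>
    (\<forall>A :: 'u cstar_algebra.
      unital_cstar_algebra A \<and> real_rank_zero A \<and> \<not> has_nonzero_findim_rep A \<longrightarrow>
      embeds_unitally B A)"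

section \<open>Quotients and minimal projections\<close>

definition closed_ideal :: "'a set \<Rightarrow> ('a, 'm) cstar_algebra_scheme \<Rightarrow> bool" where
  "closed_ideal I A \<longleftrightarrow> ideal I A \<and>
    (\<forall>X :: nat \<Rightarrow> 'a. \<forall>x\<in>carrier A. range X \<subseteq> I \<longrightarrow>
      (\<lambda>n. alg_norm A (X n \<ominus>\<^bsub>A\<^esub> x)) \<longlonglongrightarrow> 0 \<longrightarrow> x \<in> I)"

text \<open>The ring part is \<^const>\<open>FactRing\<close>; the scalar action and the involution follow its pattern
  (unions over representatives), and the norm is the quotient norm.\<close>

definition quotient_cstar ::
    "('a, 'm) cstar_algebra_scheme \<Rightarrow> 'a set \<Rightarrow> 'a set cstar_algebra" where
  "quotient_cstar A I =
     \<lparr>carrier = carrier (A Quot I), monoid.mult = monoid.mult (A Quot I), one = one (A Quot I),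
      zero = zero (A Quot I), add = add (A Quot I),
      module.smult = (\<lambda>c X. \<Union>x\<in>X. I +>\<^bsub>A\<^esub> (c \<odot>\<^bsub>A\<^esub> x)),
      star = (\<lambda>X. \<Union>x\<in>X. I +>\<^bsub>A\<^esub> star A x),
      alg_norm = (\<lambda>X. INF x\<in>X. alg_norm A x)\<rparr>"

definition projection :: "('a, 'm) star_algebra_scheme \<Rightarrow> 'a \<Rightarrow> bool" where
  "projection A p \<longleftrightarrow> self_adjoint A p \<and> p \<otimes>\<^bsub>A\<^esub> p = p"

definition subprojection :: "('a, 'm) star_algebra_scheme \<Rightarrow> 'a \<Rightarrow> 'a \<Rightarrow> bool" where
  "subprojection A q p \<longleftrightarrow>
    projection A q \<and> projection A p \<and> p \<otimes>\<^bsub>A\<^esub> q = q \<and> q \<otimes>\<^bsub>A\<^esub> p = q"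

definition minimal_nonzero_projection :: "('a, 'm) star_algebra_scheme \<Rightarrow> 'a \<Rightarrow> bool" where
  "minimal_nonzero_projection A p \<longleftrightarrow> projection A p \<and> p \<noteq> \<zero>\<^bsub>A\<^esub> \<and>
    \<not> (\<exists>q. subprojection A q p \<and> q \<noteq> \<zero>\<^bsub>A\<^esub> \<and> q \<noteq> p)"

section \<open>The trace simplex\<close>

text \<open>Tracial states are functions on the carrier; being \<^const>\<open>extensional\<close> fixes their
  (irrelevant) values elsewhere.\<close>

definition tracial_states :: "('a, 'm) cstar_algebra_scheme \<Rightarrow> ('a \<Rightarrow> complex) set" where
  "tracial_states A = {t \<in> extensional (carrier A).
     (\<forall>x\<in>carrier A. \<forall>y\<in>carrier A. t (x \<oplus>\<^bsub>A\<^esub> y) = t x + t y) \<and>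
     (\<forall>c. \<forall>x\<in>carrier A. t (c \<odot>\<^bsub>A\<^esub> x) = c * t x) \<and>
     (\<forall>x\<in>carrier A. Im (t (star A x \<otimes>\<^bsub>A\<^esub> x)) = 0 \<and> 0 \<le> Re (t (star A x \<otimes>\<^bsub>A\<^esub> x))) \<and>
     t \<one>\<^bsub>A\<^esub> = 1 \<and>
     (\<forall>x\<in>carrier A. \<forall>y\<in>carrier A. t (x \<otimes>\<^bsub>A\<^esub> y) = t (y \<otimes>\<^bsub>A\<^esub> x))}"

text \<open>
  The library's \<open>affine hull\<close> and \<open>aff_dim\<close> are not available here, since function types are not
  in the class \<^class>\<open>real_vector\<close>. A convex set of functionals is infinite-dimensional if its
  affine hull is, i.e. if no finitely many functionals affinely span it.
\<close>

definition finite_affine_hull :: "('a \<Rightarrow> complex) set \<Rightarrow> ('a \<Rightarrow> complex) set" where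
  "finite_affine_hull F =
    {\<lambda>x. \<Sum>s\<in>F. complex_of_real (c s) * s x | c :: ('a \<Rightarrow> complex) \<Rightarrow> real. sum c F = 1}"

definition infinite_dimensional :: "('a \<Rightarrow> complex) set \<Rightarrow> bool" where
  "infinite_dimensional K \<longleftrightarrow> \<not> (\<exists>F. finite F \<and> K \<subseteq> finite_affine_hull F)"

end

theory Submission
  imports
    Defs
    "HOL-Analysis.Bounded_Linear_Function"
    "HOL-Analysis.Infinite_Sum"
    "HOL-Analysis.Abstract_Topology_2"
begin

text \<open>
  For a prime \<open>p\<close>, the UHF algebra of type \<open>p\<^sup>\<infinity>\<close> has real rank zero and no finite-dimensional
  representations, so \<open>B\<close> embeds into it. The trace restricts to a tracial state \<open>t\<^sub>p\<close> of \<open>B\<close> whose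
  values on projections lie in \<open>\<int>[1/p]\<close> and are positive on non-zero projections. If \<open>T(B)\<close> were
  finite-dimensional, finitely many of the \<open>t\<^sub>p\<close> would satisfy a non-trivial real linear relation.
  The values on projections being rational, the relation may be taken with integer coefficients;
  as the denominators are powers of distinct primes, each of its terms is then an integer. So some
  \<open>t\<^sub>p\<close> takes a discrete set of values on projections, and a non-zero projection of least trace is
  minimal in \<open>B\<close>, that is, in the quotient of \<open>B\<close> by the zero ideal.
\<close>

hide_const (open) Finite_Cartesian_Product.mat

section \<open>Square-summable sequences\<close>

typedef ell2 = "{f :: nat \<Rightarrow> complex. (\<lambda>i. (cmod (f i))\<^sup>2) summable_on UNIV}"
  by (rule exI[of _ "\<lambda>_. 0"]) simp

setup_lifting type_definition_ell2

lemma square_summable_add: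
  fixes f g :: "nat \<Rightarrow> complex"
  assumes "(\<lambda>i. (cmod (f i))\<^sup>2) summable_on UNIV" "(\<lambda>i. (cmod (g i))\<^sup>2) summable_on UNIV"
  shows "(\<lambda>i. (cmod (f i + g i))\<^sup>2) summable_on UNIV"
proof (rule summable_on_comparison_test)
  show "(\<lambda>i. 2 * (cmod (f i))\<^sup>2 + 2 * (cmod (g i))\<^sup>2) summable_on UNIV"
    by (intro summable_on_add summable_on_cmult_right assms)
  fix i
  have "(cmod (f i + g i))\<^sup>2 \<le> (cmod (f i) + cmod (g i))\<^sup>2"
    by (simp add: norm_triangle_ineq power_mono)
  also have "\<dots> \<le> 2 * (cmod (f i))\<^sup>2 + 2 * (cmod (g i))\<^sup>2"
    using sum_squares_bound[of "cmod (f i)" "cmod (g i)"] by (simp add: power2_sum)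
  finally show "(cmod (f i + g i))\<^sup>2 \<le> 2 * (cmod (f i))\<^sup>2 + 2 * (cmod (g i))\<^sup>2" .
qed simp

lemma square_summable_cmult:
  fixes f :: "nat \<Rightarrow> complex"
  assumes "(\<lambda>i. (cmod (f i))\<^sup>2) summable_on UNIV"
  shows "(\<lambda>i. (cmod (c * f i))\<^sup>2) summable_on UNIV"
  using summable_on_cmult_right[OF assms, of "(cmod c)\<^sup>2"] by (simp add: norm_mult power_mult_distrib)

lemma inner_summable:
  fixes f g :: "nat \<Rightarrow> complex"
  assumes "(\<lambda>i. (cmod (f i))\<^sup>2) summable_on UNIV" "(\<lambda>i. (cmod (g i))\<^sup>2) summable_on UNIV"
  shows "(\<lambda>i. inner (f i) (g i)) summable_on UNIV"
proof (rule abs_summable_summable, rule summable_on_comparison_test)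
  show "(\<lambda>i. (cmod (f i))\<^sup>2 + (cmod (g i))\<^sup>2) summable_on UNIV"
    by (intro summable_on_add assms)
  fix i
  have "\<bar>inner (f i) (g i)\<bar> \<le> cmod (f i) * cmod (g i)"
    by (rule Cauchy_Schwarz_ineq2)
  also have "\<dots> \<le> (cmod (f i))\<^sup>2 + (cmod (g i))\<^sup>2"
    using sum_squares_bound[of "cmod (f i)" "cmod (g i)"]
      mult_nonneg_nonneg[OF norm_ge_zero[of "f i"] norm_ge_zero[of "g i"]] by linarith
  finally show "norm (inner (f i) (g i)) \<le> (cmod (f i))\<^sup>2 + (cmod (g i))\<^sup>2" by simp
qed auto

instantiation ell2 :: real_inner
begin

lift_definition zero_ell2 :: ell2 is "\<lambda>_. 0" by simp

lift_definition plus_ell2 :: "ell2 \<Rightarrow> ell2 \<Rightarrow> ell2" is "\<lambda>f g i. f i + g i"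
  by (simp add: square_summable_add)

lift_definition uminus_ell2 :: "ell2 \<Rightarrow> ell2" is "\<lambda>f i. - f i" by simp

lift_definition minus_ell2 :: "ell2 \<Rightarrow> ell2 \<Rightarrow> ell2" is "\<lambda>f g i. f i - g i"
  subgoal for f g using square_summable_add[of f "\<lambda>i. - g i"] by simp
  done

lift_definition scaleR_ell2 :: "real \<Rightarrow> ell2 \<Rightarrow> ell2" is "\<lambda>r f i. r *\<^sub>R f i"
  by (simp add: scaleR_conv_of_real square_summable_cmult del: norm_mult)

lift_definition inner_ell2 :: "ell2 \<Rightarrow> ell2 \<Rightarrow> real" is "\<lambda>f g. \<Sum>\<^sub>\<infinity>i. inner (f i) (g i)" .

definition norm_ell2 :: "ell2 \<Rightarrow> real" where "norm_ell2 x = sqrt (inner x x)"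

definition dist_ell2 :: "ell2 \<Rightarrow> ell2 \<Rightarrow> real" where "dist_ell2 x y = norm (x - y)"

definition sgn_ell2 :: "ell2 \<Rightarrow> ell2" where "sgn_ell2 x = scaleR (inverse (norm x)) x"

definition uniformity_ell2 :: "(ell2 \<times> ell2) filter"
  where "uniformity_ell2 = (INF e\<in>{0<..}. principal {(x, y). dist x y < e})"

definition open_ell2 :: "ell2 set \<Rightarrow> bool"
  where "open_ell2 U = (\<forall>x\<in>U. \<forall>\<^sub>F (x', y) in uniformity. x' = x \<longrightarrow> y \<in> U)"

instance
proof
  fix x y z :: ell2 and a b r :: real
  show "dist x y = norm (x - y)" by (rule dist_ell2_def)
  show "sgn x = scaleR (inverse (norm x)) x" by (rule sgn_ell2_def)
  show "uniformity = (INF e\<in>{0<..}. principal {(x, y). dist x (y::ell2) < e})"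
    by (rule uniformity_ell2_def)
  show "open U = (\<forall>x\<in>U. \<forall>\<^sub>F (x', y) in uniformity. x' = x \<longrightarrow> y \<in> U)" for U :: "ell2 set"
    by (rule open_ell2_def)
  show "norm x = sqrt (inner x x)" by (rule norm_ell2_def)
  show "x + y + z = x + (y + z)" "x + y = y + x" "0 + x = x" "- x + x = 0" "x - y = x + - y"
    "a *\<^sub>R (x + y) = a *\<^sub>R x + a *\<^sub>R y" "(a + b) *\<^sub>R x = a *\<^sub>R x + b *\<^sub>R x"
    "a *\<^sub>R b *\<^sub>R x = (a * b) *\<^sub>R x" "1 *\<^sub>R x = x"
    by (transfer; force simp: algebra_simps)+
  show "inner x y = inner y x" by transfer (simp add: inner_commute)
  show "inner (x + y) z = inner x z + inner y z"
    by transfer (simp add: inner_add_left infsum_add inner_summable)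
  show "inner (r *\<^sub>R x) y = r * inner x y"
    by transfer (simp add: infsum_cmult_right inner_summable)
  show "0 \<le> inner x x" by transfer (simp add: infsum_nonneg)
  show "(inner x x = 0) = (x = 0)"
  proof transfer
    fix f :: "nat \<Rightarrow> complex" assume f: "(\<lambda>i. (cmod (f i))\<^sup>2) summable_on UNIV"
    show "((\<Sum>\<^sub>\<infinity>i. inner (f i) (f i)) = 0) = (f = (\<lambda>_. 0))"
    proof
      assume "(\<Sum>\<^sub>\<infinity>i. inner (f i) (f i)) = 0"
      then have "inner (f i) (f i) = 0" for i
        using nonneg_infsum_le_0D[of "\<lambda>i. inner (f i) (f i)" UNIV i] inner_summable[OF f f] by simp
      then show "f = (\<lambda>_. 0)" by auto
    qed simp
  qed
qed

end

lift_definition coord :: "ell2 \<Rightarrow> nat \<Rightarrow> complex" is "\<lambda>f. f" .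

lemma ell2_eqI: "(\<And>i. coord x i = coord y i) \<Longrightarrow> x = y"
  by transfer auto

lemma coord_simps [simp]:
  "coord (x + y) i = coord x i + coord y i" "coord (x - y) i = coord x i - coord y i"
  "coord (- x) i = - coord x i" "coord 0 i = 0" "coord (r *\<^sub>R x) i = r *\<^sub>R coord x i"
  by (transfer, simp)+

lemma inner_ell2_eq: "inner x y = (\<Sum>\<^sub>\<infinity>i. inner (coord x i) (coord y i))"
  by transfer simp

lemma norm_ell2_sq: "(norm x)\<^sup>2 = (\<Sum>\<^sub>\<infinity>i. (cmod (coord x i))\<^sup>2)"
  unfolding power2_norm_eq_inner by (rule inner_ell2_eq)

lemma coord_summable: "(\<lambda>i. (cmod (coord x i))\<^sup>2) summable_on A"
proof -
  have "(\<lambda>i. (cmod (coord x i))\<^sup>2) summable_on UNIV" by transfer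
  then show ?thesis by (rule summable_on_subset_banach) simp
qed

lemma sum_coord_le: "finite A \<Longrightarrow> (\<Sum>i\<in>A. (cmod (coord x i))\<^sup>2) \<le> (norm x)\<^sup>2"
  unfolding norm_ell2_sq by (rule finite_sum_le_infsum) (auto simp: coord_summable)

lemma norm_coord_le: "cmod (coord x i) \<le> norm x"
  by (rule power2_le_imp_le) (use sum_coord_le[of "{i}" x] in simp_all)

lemma ell2_of_bounded_sums:
  assumes "\<And>A. finite A \<Longrightarrow> (\<Sum>i\<in>A. (cmod (f i))\<^sup>2) \<le> K\<^sup>2" "0 \<le> K"
  obtains x where "coord x = f" "norm x \<le> K"
proof -
  have s: "(\<lambda>i. (cmod (f i))\<^sup>2) summable_on UNIV"
    by (rule nonneg_bdd_above_summable_on) (auto intro!: bdd_aboveI2 assms(1))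
  define x where "x = Abs_ell2 f"
  have c: "coord x = f"
    unfolding x_def coord.rep_eq using s by (simp add: Abs_ell2_inverse)
  have "(norm x)\<^sup>2 \<le> K\<^sup>2"
    unfolding norm_ell2_sq c by (rule infsum_le_finite_sums[OF s]) (simp add: assms(1))
  then have "norm x \<le> K" using assms(2) by (rule power2_le_imp_le)
  with c show ?thesis using that by blast
qed

instance ell2 :: banach
proof
  fix X :: "nat \<Rightarrow> ell2" assume X: "Cauchy X"
  have "Cauchy (\<lambda>n. coord (X n) i)" for i
  proof (rule metric_CauchyI)
    fix e :: real assume "0 < e"
    then obtain M where M: "\<And>m n. m \<ge> M \<Longrightarrow> n \<ge> M \<Longrightarrow> dist (X m) (X n) < e"
      using X unfolding Cauchy_def by blast
    have "dist (coord (X m) i) (coord (X n) i) < e" if "m \<ge> M" "n \<ge> M" for m n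
      using norm_coord_le[of "X m - X n" i] M[OF that] by (simp add: dist_norm)
    then show "\<exists>M. \<forall>m\<ge>M. \<forall>n\<ge>M. dist (coord (X m) i) (coord (X n) i) < e" by blast
  qed
  then have "\<forall>i. \<exists>l. (\<lambda>n. coord (X n) i) \<longlonglongrightarrow> l"
    by (simp add: Cauchy_convergent_iff convergent_def)
  then obtain f where f: "\<And>i. (\<lambda>n. coord (X n) i) \<longlonglongrightarrow> f i" by metis
  have tail: "\<exists>N. \<forall>n\<ge>N. \<forall>A. finite A \<longrightarrow> (\<Sum>i\<in>A. (cmod (coord (X n) i - f i))\<^sup>2) \<le> e\<^sup>2"
    if "e > 0" for e :: real
  proof -
    obtain N where N: "\<And>m n. m \<ge> N \<Longrightarrow> n \<ge> N \<Longrightarrow> dist (X m) (X n) < e"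
      using X \<open>e > 0\<close> unfolding Cauchy_def by blast
    have "(\<Sum>i\<in>A. (cmod (coord (X n) i - f i))\<^sup>2) \<le> e\<^sup>2" if "n \<ge> N" "finite A" for n A
    proof (rule LIMSEQ_le_const2)
      show "(\<lambda>m. \<Sum>i\<in>A. (cmod (coord (X n) i - coord (X m) i))\<^sup>2)
          \<longlonglongrightarrow> (\<Sum>i\<in>A. (cmod (coord (X n) i - f i))\<^sup>2)"
        by (intro tendsto_sum tendsto_power tendsto_norm tendsto_diff tendsto_const f)
      have "(\<Sum>i\<in>A. (cmod (coord (X n) i - coord (X m) i))\<^sup>2) \<le> e\<^sup>2" if "m \<ge> N" for m
      proof -
        have "(\<Sum>i\<in>A. (cmod (coord (X n - X m) i))\<^sup>2) \<le> (norm (X n - X m))\<^sup>2"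
          using \<open>finite A\<close> by (rule sum_coord_le)
        also have "\<dots> \<le> e\<^sup>2"
          using N[OF \<open>n \<ge> N\<close> that] by (intro power_mono) (simp_all add: dist_norm)
        finally show ?thesis by simp
      qed
      then show "\<exists>M. \<forall>m\<ge>M. (\<Sum>i\<in>A. (cmod (coord (X n) i - coord (X m) i))\<^sup>2) \<le> e\<^sup>2" by blast
    qed
    then show ?thesis by blast
  qed
  have "(0::real) < 1" by simp
  from tail[OF this] obtain N
    where N: "\<And>A. finite A \<Longrightarrow> (\<Sum>i\<in>A. (cmod (coord (X N) i - f i))\<^sup>2) \<le> 1\<^sup>2"
    by blast
  obtain d where d: "coord d = (\<lambda>i. coord (X N) i - f i)"
    by (rule ell2_of_bounded_sums[OF N]) simp_all
  define x where "x = X N - d"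
  have x: "coord x i = f i" for i by (simp add: x_def d)
  have "X \<longlonglongrightarrow> x"
  proof (rule metric_LIMSEQ_I)
    fix e :: real assume "0 < e"
    then have "0 < e / 2" by simp
    from tail[OF this] obtain N where N: "\<And>n A. n \<ge> N \<Longrightarrow> finite A \<Longrightarrow>
        (\<Sum>i\<in>A. (cmod (coord (X n) i - f i))\<^sup>2) \<le> (e/2)\<^sup>2"
      by blast
    have "dist (X n) x < e" if n: "n \<ge> N" for n
    proof -
      obtain y where y: "coord y = (\<lambda>i. coord (X n) i - f i)" "norm y \<le> e/2"
        by (rule ell2_of_bounded_sums[OF N[OF n]]) (use \<open>0 < e\<close> in simp_all)
      have "X n - x = y" by (rule ell2_eqI) (simp add: x y)
      then show ?thesis using y \<open>0 < e\<close> by (simp add: dist_norm)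
    qed
    then show "\<exists>no. \<forall>n\<ge>no. dist (X n) x < e" by blast
  qed
  then show "convergent X" by (auto simp: convergent_def)
qed

lift_definition cscale :: "complex \<Rightarrow> ell2 \<Rightarrow> ell2" is "\<lambda>c f i. c * f i"
  by (rule square_summable_cmult)

lift_definition basis_vec :: "nat \<Rightarrow> ell2" is "\<lambda>i j. if j = i then 1 else 0"
  by (rule finite_nonzero_values_imp_summable_on) auto

lemma coord_cscale [simp]: "coord (cscale c x) i = c * coord x i"
  by transfer simp

lemma coord_basis_vec: "coord (basis_vec i) j = (if j = i then 1 else 0)"
  by transfer simp

lemma inner_cscale: "inner (cscale c x) y = inner x (cscale (cnj c) y)"
  unfolding inner_ell2_eq by (rule infsum_cong) (simp add: inner_complex_def ring_distribs ac_simps)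

lemma norm_cscale: "norm (cscale c x) = cmod c * norm x"
proof -
  have "(norm (cscale c x))\<^sup>2 = (\<Sum>\<^sub>\<infinity>i. (cmod c)\<^sup>2 * (cmod (coord x i))\<^sup>2)"
    unfolding norm_ell2_sq by (rule infsum_cong) (simp add: norm_mult power_mult_distrib)
  also have "\<dots> = (cmod c)\<^sup>2 * (norm x)\<^sup>2"
    unfolding norm_ell2_sq by (rule infsum_cmult_right) (rule coord_summable)
  finally show ?thesis
    by (simp add: power_mult_distrib[symmetric] power2_eq_iff_nonneg)
qed

lemma inner_basis_vec: "inner (cscale c (basis_vec i)) x = inner c (coord x i)"
proof -
  have "inner (cscale c (basis_vec i)) x = (\<Sum>\<^sub>\<infinity>j. if j = i then inner c (coord x i) else 0)"
    unfolding inner_ell2_eq by (rule infsum_cong) (auto simp: coord_basis_vec)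
  also have "\<dots> = (\<Sum>\<^sub>\<infinity>j\<in>{i}. inner c (coord x i))"
    by (rule infsum_cong_neutral) auto
  finally show ?thesis by simp
qed

lemma cscale_one [simp]: "cscale 1 x = x"
  by (rule ell2_eqI) simp

lemma norm_basis_vec [simp]: "norm (basis_vec i) = 1"
proof -
  have "(norm (basis_vec i))\<^sup>2 = 1\<^sup>2"
    using inner_basis_vec[of 1 i "basis_vec i"] by (simp add: power2_norm_eq_inner coord_basis_vec del: dot_square_norm)
  then show ?thesis by (simp only: power2_eq_iff_nonneg norm_ge_zero zero_le_one)
qed

section \<open>Bounded operators\<close>

text \<open>A copy of the type of bounded real-linear operators which can be made a ring. The real
  adjoint of a complex-linear operator is its complex adjoint, so all inner products are real and
  the complex scalars act as operators \<open>csc c\<close>.\<close>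

lifting_forget ell2.lifting

typedef bop = "UNIV :: (ell2 \<Rightarrow>\<^sub>L ell2) set" ..

setup_lifting type_definition_bop

lift_definition app :: "bop \<Rightarrow> ell2 \<Rightarrow> ell2" (infixr "\<cdot>\<^sub>o" 75) is blinfun_apply .

instantiation bop :: real_normed_algebra_1
begin

lift_definition zero_bop :: bop is 0 .
lift_definition one_bop :: bop is id_blinfun .
lift_definition plus_bop :: "bop \<Rightarrow> bop \<Rightarrow> bop" is "(+)" .
lift_definition minus_bop :: "bop \<Rightarrow> bop \<Rightarrow> bop" is "(-)" .
lift_definition uminus_bop :: "bop \<Rightarrow> bop" is uminus .
lift_definition times_bop :: "bop \<Rightarrow> bop \<Rightarrow> bop" is blinfun_compose .
lift_definition scaleR_bop :: "real \<Rightarrow> bop \<Rightarrow> bop" is scaleR .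
lift_definition norm_bop :: "bop \<Rightarrow> real" is norm .

definition dist_bop :: "bop \<Rightarrow> bop \<Rightarrow> real" where "dist_bop x y = norm (x - y)"

definition sgn_bop :: "bop \<Rightarrow> bop" where "sgn_bop x = scaleR (inverse (norm x)) x"

definition uniformity_bop :: "(bop \<times> bop) filter"
  where "uniformity_bop = (INF e\<in>{0<..}. principal {(x, y). dist x y < e})"

definition open_bop :: "bop set \<Rightarrow> bool"
  where "open_bop U = (\<forall>x\<in>U. \<forall>\<^sub>F (x', y) in uniformity. x' = x \<longrightarrow> y \<in> U)"

instance
proof
  fix x y z :: bop and a b r :: real
  show "dist x y = norm (x - y)" by (rule dist_bop_def)
  show "sgn x = scaleR (inverse (norm x)) x" by (rule sgn_bop_def)
  show "uniformity = (INF e\<in>{0<..}. principal {(x, y). dist x (y::bop) < e})"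
    by (rule uniformity_bop_def)
  show "open U = (\<forall>x\<in>U. \<forall>\<^sub>F (x', y) in uniformity. x' = x \<longrightarrow> y \<in> U)" for U :: "bop set"
    by (rule open_bop_def)
  show "x + y + z = x + (y + z)" "x + y = y + x" "0 + x = x" "- x + x = 0" "x - y = x + - y"
    "a *\<^sub>R (x + y) = a *\<^sub>R x + a *\<^sub>R y" "(a + b) *\<^sub>R x = a *\<^sub>R x + b *\<^sub>R x"
    "a *\<^sub>R b *\<^sub>R x = (a * b) *\<^sub>R x" "1 *\<^sub>R x = x"
    by (transfer; simp add: algebra_simps)+
  show "x * y * z = x * (y * z)" "1 * x = x" "x * 1 = x" "(x + y) * z = x * z + y * z"
    "x * (y + z) = x * y + x * z" "a *\<^sub>R x * y = a *\<^sub>R (x * y)" "x * a *\<^sub>R y = a *\<^sub>R (x * y)"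
    by (transfer; rule blinfun_eqI; simp add: algebra_simps blinfun.bilinear_simps)+
  show "(norm x = 0) = (x = 0)" "norm (x + y) \<le> norm x + norm y" "norm (a *\<^sub>R x) = \<bar>a\<bar> * norm x"
    by (transfer; simp add: norm_triangle_ineq)+
  show "norm (x * y) \<le> norm x * norm y" by transfer (rule norm_blinfun_compose)
  have "(0::ell2 \<Rightarrow>\<^sub>L ell2) \<noteq> id_blinfun"
  proof
    assume "(0::ell2 \<Rightarrow>\<^sub>L ell2) = id_blinfun"
    then have "blinfun_apply 0 (basis_vec 0) = blinfun_apply id_blinfun (basis_vec 0)" by simp
    then have "norm (basis_vec 0) = 0" by simp
    then show False by simp
  qed
  then show "(0::bop) \<noteq> 1" by transfer
  show "norm (1::bop) = 1"
  proof transfer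
    show "norm (id_blinfun :: ell2 \<Rightarrow>\<^sub>L ell2) = 1"
    proof (rule antisym)
      show "norm (id_blinfun :: ell2 \<Rightarrow>\<^sub>L ell2) \<le> 1" by (rule norm_blinfun_bound) auto
      show "1 \<le> norm (id_blinfun :: ell2 \<Rightarrow>\<^sub>L ell2)"
        using norm_blinfun[of "id_blinfun" "basis_vec 0"] by simp
    qed
  qed
qed

end

instance bop :: banach
proof
  fix X :: "nat \<Rightarrow> bop" assume "Cauchy X"
  then have "Cauchy (\<lambda>n. Rep_bop (X n))"
    unfolding Cauchy_def dist_norm norm_bop.rep_eq minus_bop.rep_eq .
  then obtain L where L: "(\<lambda>n. Rep_bop (X n)) \<longlonglongrightarrow> L"
    by (auto simp: Cauchy_convergent_iff convergent_def)
  have "X \<longlonglongrightarrow> Abs_bop L"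
    using L unfolding lim_sequentially dist_norm norm_bop.rep_eq minus_bop.rep_eq
    by (simp add: Abs_bop_inverse)
  then show "convergent X" by (auto simp: convergent_def)
qed

lemma bop_eqI: "(\<And>f. S \<cdot>\<^sub>o f = T \<cdot>\<^sub>o f) \<Longrightarrow> S = T"
  by transfer (auto intro: blinfun_eqI)

lemma app_simps [simp]:
  "(S + T) \<cdot>\<^sub>o f = S \<cdot>\<^sub>o f + T \<cdot>\<^sub>o f" "(S - T) \<cdot>\<^sub>o f = S \<cdot>\<^sub>o f - T \<cdot>\<^sub>o f"
  "(- S) \<cdot>\<^sub>o f = - (S \<cdot>\<^sub>o f)" "0 \<cdot>\<^sub>o f = 0" "1 \<cdot>\<^sub>o f = f" "(r *\<^sub>R S) \<cdot>\<^sub>o f = r *\<^sub>R (S \<cdot>\<^sub>o f)"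
  "(S * T) \<cdot>\<^sub>o f = S \<cdot>\<^sub>o T \<cdot>\<^sub>o f" "S \<cdot>\<^sub>o 0 = 0" "S \<cdot>\<^sub>o (- f) = - (S \<cdot>\<^sub>o f)"
  "S \<cdot>\<^sub>o (f + g) = S \<cdot>\<^sub>o f + S \<cdot>\<^sub>o g" "S \<cdot>\<^sub>o (f - g) = S \<cdot>\<^sub>o f - S \<cdot>\<^sub>o g"
  "S \<cdot>\<^sub>o (r *\<^sub>R f) = r *\<^sub>R (S \<cdot>\<^sub>o f)"
  by (transfer; simp add: blinfun.bilinear_simps)+

lemma norm_app_le: "norm (S \<cdot>\<^sub>o f) \<le> norm S * norm f"
  by transfer (rule norm_blinfun)

lemma norm_bop_bound: "0 \<le> K \<Longrightarrow> (\<And>f. norm (S \<cdot>\<^sub>o f) \<le> K * norm f) \<Longrightarrow> norm S \<le> K"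
  by transfer (rule norm_blinfun_bound)

lemma bop_of_bounded_linear:
  assumes "bounded_linear F" obtains S where "\<And>f. S \<cdot>\<^sub>o f = F f"
proof
  show "Abs_bop (Blinfun F) \<cdot>\<^sub>o f = F f" for f
    by (simp add: app.abs_eq assms bounded_linear_Blinfun_apply)
qed

lemma tendsto_app:
  assumes "X \<longlonglongrightarrow> S" shows "(\<lambda>n. X n \<cdot>\<^sub>o f) \<longlonglongrightarrow> S \<cdot>\<^sub>o f"
proof (rule LIM_zero_cancel, rule Lim_null_comparison)
  have "(\<lambda>n. norm (X n - S)) \<longlonglongrightarrow> 0"
    using assms by (simp add: LIM_zero tendsto_norm_zero)
  then show "(\<lambda>n. norm (X n - S) * norm f) \<longlonglongrightarrow> 0" by (rule tendsto_mult_left_zero)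
  have "norm (X n \<cdot>\<^sub>o f - S \<cdot>\<^sub>o f) \<le> norm (X n - S) * norm f" for n
    using norm_app_le[of "X n - S" f] by simp
  then show "\<forall>\<^sub>F n in sequentially. norm (X n \<cdot>\<^sub>o f - S \<cdot>\<^sub>o f) \<le> norm (X n - S) * norm f" by simp
qed

definition csc :: "complex \<Rightarrow> bop" where "csc c = Abs_bop (Blinfun (cscale c))"

lemma app_csc [simp]: "csc c \<cdot>\<^sub>o f = cscale c f"
proof -
  have "bounded_linear (cscale c)"
  proof (rule bounded_linear_intro)
    show "cscale c (x + y) = cscale c x + cscale c y" for x y
      by (rule ell2_eqI) (simp add: algebra_simps)
    show "cscale c (r *\<^sub>R x) = r *\<^sub>R cscale c x" for r x
      by (rule ell2_eqI) (simp add: algebra_simps)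
    show "norm (cscale c x) \<le> norm x * cmod c" for x
      by (simp add: norm_cscale mult.commute)
  qed
  then show ?thesis
    by (simp add: csc_def app.abs_eq bounded_linear_Blinfun_apply)
qed

lemma csc_mult: "csc c * csc d = csc (c * d)"
  and csc_add: "csc c + csc d = csc (c + d)"
  and csc_of_real: "csc (of_real r) = r *\<^sub>R 1"
  by (auto intro!: bop_eqI ell2_eqI simp: algebra_simps scaleR_conv_of_real[where 'a = complex])

lemma csc_1 [simp]: "csc 1 = 1" and csc_0 [simp]: "csc 0 = 0"
  using csc_of_real[of 1] csc_of_real[of 0] by auto

lemma norm_csc_mult: "norm (csc c * S) = cmod c * norm S"
proof (rule antisym)
  have le: "norm (csc c * S) \<le> cmod c * norm S" for c S
    by (rule norm_bop_bound)
       (auto simp: norm_cscale mult.assoc intro!: mult_left_mono norm_app_le)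
  then show "norm (csc c * S) \<le> cmod c * norm S" .
  show "cmod c * norm S \<le> norm (csc c * S)"
  proof (cases "c = 0")
    case False
    have "norm S = norm (csc (inverse c) * (csc c * S))"
      using False by (simp add: mult.assoc[symmetric] csc_mult)
    then have "cmod c * norm S \<le> cmod c * (cmod (inverse c) * norm (csc c * S))"
      using le[of "inverse c" "csc c * S"] by (simp add: mult_left_mono)
    also have "\<dots> = norm (csc c * S)" using False by (simp add: norm_inverse)
    finally show ?thesis .
  qed simp
qed

definition is_adj :: "bop \<Rightarrow> bop \<Rightarrow> bool" where
  "is_adj S T \<longleftrightarrow> (\<forall>f g. inner (S \<cdot>\<^sub>o f) g = inner f (T \<cdot>\<^sub>o g))"

lemma is_adj_sym: "is_adj S T \<Longrightarrow> is_adj T S"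
  unfolding is_adj_def by (simp add: inner_commute)

lemma is_adj_unique: assumes "is_adj S T" "is_adj S T'" shows "T = T'"
proof (rule bop_eqI)
  fix f
  have "\<forall>g. inner g (T \<cdot>\<^sub>o f) = inner g (T' \<cdot>\<^sub>o f)"
    using assms unfolding is_adj_def by metis
  then show "T \<cdot>\<^sub>o f = T' \<cdot>\<^sub>o f" by (simp only: vector_eq_ldot)
qed

lemma is_adj_norm_le: assumes "is_adj S T" shows "norm S \<le> norm T"
proof (rule norm_bop_bound)
  fix f
  have "(norm (S \<cdot>\<^sub>o f))\<^sup>2 = inner f (T \<cdot>\<^sub>o S \<cdot>\<^sub>o f)"
    using assms unfolding is_adj_def power2_norm_eq_inner by simp
  also have "\<dots> \<le> norm f * norm (T \<cdot>\<^sub>o S \<cdot>\<^sub>o f)"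
    by (rule norm_cauchy_schwarz)
  also have "\<dots> \<le> norm f * (norm T * norm (S \<cdot>\<^sub>o f))"
    by (intro mult_left_mono norm_app_le norm_ge_zero)
  finally have "norm (S \<cdot>\<^sub>o f) * norm (S \<cdot>\<^sub>o f) \<le> (norm T * norm f) * norm (S \<cdot>\<^sub>o f)"
    by (simp add: power2_eq_square algebra_simps)
  then show "norm (S \<cdot>\<^sub>o f) \<le> norm T * norm f"
    by (cases "norm (S \<cdot>\<^sub>o f) = 0") (auto simp: mult_le_cancel_right)
qed simp

lemma is_adj_norm: "is_adj S T \<Longrightarrow> norm S = norm T"
  by (meson antisym is_adj_norm_le is_adj_sym)

lemma is_adj_cstar: assumes "is_adj S T" shows "norm (T * S) = (norm S)\<^sup>2"
proof (rule antisym)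
  show "norm (T * S) \<le> (norm S)\<^sup>2"
    using norm_mult_ineq[of T S] is_adj_norm[OF assms] by (simp add: power2_eq_square)
  have "norm S \<le> sqrt (norm (T * S))"
  proof (rule norm_bop_bound)
    fix f
    have "(norm (S \<cdot>\<^sub>o f))\<^sup>2 = inner f ((T * S) \<cdot>\<^sub>o f)"
      using assms unfolding is_adj_def power2_norm_eq_inner by simp
    also have "\<dots> \<le> norm f * norm ((T * S) \<cdot>\<^sub>o f)"
      by (rule norm_cauchy_schwarz)
    also have "\<dots> \<le> norm f * (norm (T * S) * norm f)"
      by (intro mult_left_mono norm_app_le norm_ge_zero)
    also have "\<dots> = (sqrt (norm (T * S)) * norm f)\<^sup>2"
      by (simp add: power_mult_distrib) (simp add: power2_eq_square)
    finally show "norm (S \<cdot>\<^sub>o f) \<le> sqrt (norm (T * S)) * norm f"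
      by (rule power2_le_imp_le) simp
  qed simp
  then have "(norm S)\<^sup>2 \<le> (sqrt (norm (T * S)))\<^sup>2" by (rule power_mono) simp
  then show "(norm S)\<^sup>2 \<le> norm (T * S)" by simp
qed

lemma is_adj_add: "is_adj S T \<Longrightarrow> is_adj S' T' \<Longrightarrow> is_adj (S + S') (T + T')"
  and is_adj_diff: "is_adj S T \<Longrightarrow> is_adj S' T' \<Longrightarrow> is_adj (S - S') (T - T')"
  and is_adj_mult: "is_adj S T \<Longrightarrow> is_adj S' T' \<Longrightarrow> is_adj (S * S') (T' * T)"
  and is_adj_one: "is_adj 1 1"
  and is_adj_zero: "is_adj 0 0"
  and is_adj_scaleR: "is_adj S T \<Longrightarrow> is_adj (r *\<^sub>R S) (r *\<^sub>R T)"
  and is_adj_csc: "is_adj (csc c) (csc (cnj c))"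
  by (auto simp: is_adj_def inner_add_left inner_add_right inner_diff_left inner_diff_right inner_cscale)

lemma is_adj_sum: "(\<And>i. i \<in> I \<Longrightarrow> is_adj (S i) (T i)) \<Longrightarrow> is_adj (sum S I) (sum T I)"
  by (induction I rule: infinite_finite_induct) (auto intro: is_adj_add is_adj_zero)

lemma is_adj_limit:
  assumes "X \<longlonglongrightarrow> S" "\<And>n. is_adj (X n) (Y n)"
  obtains T where "Y \<longlonglongrightarrow> T" "is_adj S T"
proof -
  have eq: "norm (Y m - Y n) = norm (X m - X n)" for m n
    using is_adj_norm[OF is_adj_diff[OF assms(2)[of m] assms(2)[of n]]] by simp
  have "Cauchy X" using assms(1) by (rule LIMSEQ_imp_Cauchy)
  then have "Cauchy Y" unfolding Cauchy_def dist_norm eq .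
  then obtain T where T: "Y \<longlonglongrightarrow> T" by (auto simp: Cauchy_convergent_iff convergent_def)
  have "inner (S \<cdot>\<^sub>o f) g = inner f (T \<cdot>\<^sub>o g)" for f g
  proof (rule LIMSEQ_unique)
    show "(\<lambda>n. inner (X n \<cdot>\<^sub>o f) g) \<longlonglongrightarrow> inner (S \<cdot>\<^sub>o f) g"
      by (intro tendsto_inner tendsto_const tendsto_app assms)
    have "(\<lambda>n. inner f (Y n \<cdot>\<^sub>o g)) \<longlonglongrightarrow> inner f (T \<cdot>\<^sub>o g)"
      by (intro tendsto_inner tendsto_const tendsto_app T)
    then show "(\<lambda>n. inner (X n \<cdot>\<^sub>o f) g) \<longlonglongrightarrow> inner f (T \<cdot>\<^sub>o g)"
      using assms(2) by (simp add: is_adj_def)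
  qed
  with T show ?thesis using that by (auto simp: is_adj_def)
qed

definition adjoint :: "bop \<Rightarrow> bop" where "adjoint S = (THE T. is_adj S T)"

lemma adjoint_eq: "is_adj S T \<Longrightarrow> adjoint S = T"
  unfolding adjoint_def by (blast intro: is_adj_unique)

definition entry :: "bop \<Rightarrow> nat \<Rightarrow> nat \<Rightarrow> complex" where
  "entry S i j = coord (S \<cdot>\<^sub>o basis_vec j) i"

lemma entry_simps [simp]:
  "entry (S + T) i j = entry S i j + entry T i j" "entry (S - T) i j = entry S i j - entry T i j"
  "entry (csc c * S) i j = c * entry S i j" "entry 1 i j = (if i = j then 1 else 0)"
  by (auto simp: entry_def coord_basis_vec)

lemma norm_entry_le: "cmod (entry S i j) \<le> norm S"
  unfolding entry_def using norm_coord_le norm_app_le[of S "basis_vec j"] by (rule order_trans[OF _ order_trans]) simp_all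

section \<open>Matrix units\<close>

text \<open>Writing \<open>m = N d + r\<close> with \<open>r < N\<close> identifies \<open>\<ell>\<^sup>2(\<nat>)\<close> with \<open>\<complex>\<^sup>N \<otimes> \<ell>\<^sup>2(\<nat>)\<close>;
  \<open>munit N i j\<close> is \<open>e\<^sub>i\<^sub>j \<otimes> 1\<close>.\<close>

definition munit :: "nat \<Rightarrow> nat \<Rightarrow> nat \<Rightarrow> bop" where
  "munit N i j = (SOME S. \<forall>f m. coord (S \<cdot>\<^sub>o f) m = (if m mod N = i then coord f (m - i + j) else 0))"

lemma coord_munit:
  "coord (munit N i j \<cdot>\<^sub>o f) m = (if m mod N = i then coord f (m - i + j) else 0)"
proof -
  let ?P = "\<lambda>f g. \<forall>m. coord g m = (if m mod N = i then coord f (m - i + j) else 0)"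
  have ex: "\<exists>g. ?P f g \<and> norm g \<le> norm f" for f
  proof -
    have "(\<Sum>m\<in>A. (cmod (if m mod N = i then coord f (m - i + j) else 0))\<^sup>2) \<le> (norm f)\<^sup>2"
      if "finite A" for A
    proof -
      let ?A = "{m\<in>A. m mod N = i}"
      have inj: "inj_on (\<lambda>m. m - i + j) ?A"
      proof (rule inj_onI)
        fix x y assume a: "x \<in> ?A" "y \<in> ?A" "x - i + j = y - i + j"
        moreover have "i \<le> x" "i \<le> y" using a mod_less_eq_dividend[of x N] mod_less_eq_dividend[of y N] by auto
        ultimately show "x = y" by simp
      qed
      have "(\<Sum>m\<in>A. (cmod (if m mod N = i then coord f (m - i + j) else 0))\<^sup>2)
          = (\<Sum>m\<in>?A. (cmod (coord f (m - i + j)))\<^sup>2)"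
        using that by (intro sum.mono_neutral_cong_right) auto
      also have "\<dots> = (\<Sum>m\<in>(\<lambda>m. m - i + j) ` ?A. (cmod (coord f m))\<^sup>2)"
        by (simp add: sum.reindex[OF inj])
      also have "\<dots> \<le> (norm f)\<^sup>2" using that by (intro sum_coord_le) auto
      finally show ?thesis .
    qed
    from ell2_of_bounded_sums[OF this norm_ge_zero] obtain g
      where "coord g = (\<lambda>m. if m mod N = i then coord f (m - i + j) else 0)" "norm g \<le> norm f"
      by blast
    then show ?thesis by (intro exI[of _ g]) simp
  qed
  then obtain F where F: "\<And>f. ?P f (F f)" "\<And>f. norm (F f) \<le> norm f"
    using choice[of "\<lambda>f g. ?P f g \<and> norm g \<le> norm f"] by blast
  have "bounded_linear F"
  proof (rule bounded_linear_intro)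
    show "F (x + y) = F x + F y" for x y by (rule ell2_eqI) (simp add: F(1))
    show "F (r *\<^sub>R x) = r *\<^sub>R F x" for r x by (rule ell2_eqI) (simp add: F(1))
    show "norm (F x) \<le> norm x * 1" for x using F(2) by simp
  qed
  from bop_of_bounded_linear[OF this] obtain S where "\<And>f. S \<cdot>\<^sub>o f = F f" by blast
  then have "\<exists>S. \<forall>f m. coord (S \<cdot>\<^sub>o f) m = (if m mod N = i then coord f (m - i + j) else 0)"
    using F(1) by (intro exI[of _ S]) simp
  from someI_ex[OF this] show ?thesis unfolding munit_def by blast
qed

lemma block_mod:
  assumes "j < (N::nat)" shows "(m - m mod N + j) mod N = j" "m - m mod N + j - j = m - m mod N"
proof -
  have "m - m mod N = N * (m div N)" by (simp add: minus_mod_eq_mult_div)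
  then show "(m - m mod N + j) mod N = j" using assms by simp
qed simp

lemma is_adj_munit:
  assumes "i < N" "j < N" shows "is_adj (munit N i j) (munit N j i)"
  unfolding is_adj_def
proof (intro allI)
  fix f g
  have b: "bij_betw (\<lambda>m. m - i + j) {m. m mod N = i} {m. m mod N = j}"
  proof (rule bij_betwI[where g = "\<lambda>m. m - j + i"])
    show "(\<lambda>m. m - i + j) \<in> {m. m mod N = i} \<rightarrow> {m. m mod N = j}"
      using block_mod(1)[OF assms(2)] by auto
    show "(\<lambda>m. m - j + i) \<in> {m. m mod N = j} \<rightarrow> {m. m mod N = i}"
      using block_mod(1)[OF assms(1)] by auto
    show "x - i + j - j + i = x" if "x \<in> {m. m mod N = i}" for x
      using that mod_less_eq_dividend[of x N] by auto
    show "x - j + i - i + j = x" if "x \<in> {m. m mod N = j}" for x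
      using that mod_less_eq_dividend[of x N] by auto
  qed
  have "inner (munit N i j \<cdot>\<^sub>o f) g = (\<Sum>\<^sub>\<infinity>m\<in>{m. m mod N = i}. inner (coord f (m - i + j)) (coord g m))"
    unfolding inner_ell2_eq by (rule infsum_cong_neutral) (auto simp: coord_munit)
  also have "\<dots> = (\<Sum>\<^sub>\<infinity>m\<in>{m. m mod N = i}. (\<lambda>m. inner (coord f m) (coord g (m - j + i))) (m - i + j))"
  proof (rule infsum_cong)
    fix x assume "x \<in> {m. m mod N = i}"
    then have "x - i + j - j + i = x" using mod_less_eq_dividend[of x N] by auto
    then show "inner (coord f (x - i + j)) (coord g x)
      = inner (coord f (x - i + j)) (coord g (x - i + j - j + i))" by simp
  qed
  also have "\<dots> = (\<Sum>\<^sub>\<infinity>m\<in>{m. m mod N = j}. inner (coord f m) (coord g (m - j + i)))"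
    by (rule infsum_reindex_bij_betw[OF b])
  also have "\<dots> = inner f (munit N j i \<cdot>\<^sub>o g)"
    unfolding inner_ell2_eq by (rule infsum_cong_neutral) (auto simp: coord_munit)
  finally show "inner (munit N i j \<cdot>\<^sub>o f) g = inner f (munit N j i \<cdot>\<^sub>o g)" .
qed

definition opm :: "nat \<Rightarrow> complex mat \<Rightarrow> bop" where
  "opm N a = (\<Sum>i<N. \<Sum>j<N. csc (a $$ (i, j)) * munit N i j)"

lemma app_sum: "(sum S I) \<cdot>\<^sub>o f = (\<Sum>i\<in>I. S i \<cdot>\<^sub>o f)"
  by (induction I rule: infinite_finite_induct) auto

lemma coord_sum: "coord (sum x I) m = (\<Sum>i\<in>I. coord (x i) m)"
  by (induction I rule: infinite_finite_induct) auto

lemma coord_opm: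
  assumes "0 < N"
  shows "coord (opm N a \<cdot>\<^sub>o f) m = (\<Sum>j<N. a $$ (m mod N, j) * coord f (m - m mod N + j))"
proof -
  have "coord (opm N a \<cdot>\<^sub>o f) m
      = (\<Sum>i<N. if i = m mod N then \<Sum>j<N. a $$ (m mod N, j) * coord f (m - m mod N + j) else 0)"
    unfolding opm_def app_sum coord_sum
    by (rule sum.cong) (auto simp: coord_munit)
  then show ?thesis using assms by simp
qed

lemma opm_add:
  assumes "a \<in> carrier_mat N N" "b \<in> carrier_mat N N"
  shows "opm N a + opm N b = opm N (a + b)"
proof -
  have "opm N (a + b) = (\<Sum>i<N. \<Sum>j<N. csc (a $$ (i, j)) * munit N i j + csc (b $$ (i, j)) * munit N i j)"
    unfolding opm_def using assms by (intro sum.cong refl) (simp add: csc_add[symmetric] distrib_right)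
  then show ?thesis by (simp only: opm_def sum.distrib)
qed

lemma csc_opm: "a \<in> carrier_mat N N \<Longrightarrow> csc c * opm N a = opm N (c \<cdot>\<^sub>m a)"
  unfolding opm_def sum_distrib_left
  by (intro sum.cong refl) (simp add: mult.assoc[symmetric] csc_mult)

lemma csc_munit: "csc c * munit N i j = munit N i j * csc c"
  by (intro bop_eqI ell2_eqI) (simp add: coord_munit)

lemma opm_csc: "opm N a * csc c = csc c * opm N a"
  unfolding opm_def sum_distrib_left sum_distrib_right
proof (intro sum.cong refl)
  fix i j
  have "csc (a $$ (i, j)) * munit N i j * csc c = csc (a $$ (i, j)) * csc c * munit N i j"
    by (simp only: mult.assoc csc_munit[of c])
  then show "csc (a $$ (i, j)) * munit N i j * csc c = csc c * (csc (a $$ (i, j)) * munit N i j)"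
    by (simp add: mult.assoc[symmetric] csc_mult mult.commute)
qed

lemma opm_mult:
  assumes "0 < N" "a \<in> carrier_mat N N" "b \<in> carrier_mat N N"
  shows "opm N a * opm N b = opm N (a * b)"
proof (intro bop_eqI ell2_eqI)
  fix f m
  have r: "m mod N < N" using assms by simp
  have "coord ((opm N a * opm N b) \<cdot>\<^sub>o f) m
      = (\<Sum>j<N. a $$ (m mod N, j) * (\<Sum>k<N. b $$ (j, k) * coord f (m - m mod N + k)))"
    unfolding app_simps coord_opm[OF assms(1)]
    by (intro sum.cong refl) (simp only: lessThan_iff block_mod)
  also have "\<dots> = (\<Sum>k<N. (\<Sum>j<N. a $$ (m mod N, j) * b $$ (j, k)) * coord f (m - m mod N + k))"
    unfolding sum_distrib_left sum_distrib_right by (subst sum.swap) (simp add: mult.assoc)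
  also have "\<dots> = coord (opm N (a * b) \<cdot>\<^sub>o f) m"
    unfolding coord_opm[OF assms(1)]
    using assms r by (auto intro!: sum.cong simp: scalar_prod_def atLeast0LessThan)
  finally show "coord ((opm N a * opm N b) \<cdot>\<^sub>o f) m = coord (opm N (a * b) \<cdot>\<^sub>o f) m" .
qed

lemma opm_one: assumes "0 < N" shows "opm N (1\<^sub>m N) = 1"
proof (intro bop_eqI ell2_eqI)
  fix f m
  have r: "m mod N < N" using assms by simp
  have "coord (opm N (1\<^sub>m N) \<cdot>\<^sub>o f) m = (\<Sum>j<N. if j = m mod N then coord f m else 0)"
    unfolding coord_opm[OF assms] using r by (intro sum.cong) auto
  then show "coord (opm N (1\<^sub>m N) \<cdot>\<^sub>o f) m = coord (1 \<cdot>\<^sub>o f) m" using r by simp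
qed

lemma mat_adjoint_index:
  "a \<in> carrier_mat N N \<Longrightarrow> i < N \<Longrightarrow> j < N \<Longrightarrow> mat_adjoint a $$ (i, j) = cnj (a $$ (j, i))"
  by (auto simp: mat_adjoint_def mat_of_rows_index)

lemma mat_adjoint_carrier: "a \<in> carrier_mat N N \<Longrightarrow> mat_adjoint a \<in> carrier_mat N N"
  unfolding mat_adjoint_def mat_of_rows_def by auto

lemma is_adj_opm:
  assumes "a \<in> carrier_mat N N" shows "is_adj (opm N a) (opm N (mat_adjoint a))"
proof -
  have "is_adj (opm N a) (\<Sum>i<N. \<Sum>j<N. munit N j i * csc (cnj (a $$ (i, j))))"
    unfolding opm_def by (intro is_adj_sum is_adj_mult is_adj_csc is_adj_munit) auto
  also have "(\<Sum>i<N. \<Sum>j<N. munit N j i * csc (cnj (a $$ (i, j)))) = opm N (mat_adjoint a)"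
    unfolding opm_def using assms
    by (subst sum.swap) (auto intro!: sum.cong simp: mat_adjoint_index csc_munit)
  finally show ?thesis .
qed

lemma sum_single_term:
  "finite A \<Longrightarrow> j \<in> A \<Longrightarrow> (\<And>i. i \<in> A \<Longrightarrow> i \<noteq> j \<Longrightarrow> f i = 0) \<Longrightarrow> sum f A = f j"
  by (subst sum.remove[of A j]) (auto intro: sum.neutral)

lemma munit_eq_opm:
  assumes "i < N" "j < N"
  shows "munit N i j = opm N (mat N N (\<lambda>(k, l). if k = i \<and> l = j then 1 else 0))" (is "_ = opm N ?a")
proof -
  have "(\<Sum>l<N. csc (?a $$ (k, l)) * munit N k l) = (if k = i then munit N i j else 0)" if "k < N" for k
    using assms that by (subst sum_single_term[of _ j]) auto
  then have "opm N ?a = (\<Sum>k<N. if k = i then munit N i j else 0)"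
    unfolding opm_def by (intro sum.cong) auto
  then show ?thesis using assms by simp
qed

lemma munit_mult:
  assumes "j < N"
  shows "munit N i j * munit N k l = (if j = k then munit N i l else 0)"
proof (intro bop_eqI ell2_eqI)
  fix f m
  have "(m - i + j) mod N = j" "m - i + j - j = m - i" if "m mod N = i"
    using block_mod[OF assms, of m] that by simp_all
  then have "coord ((munit N i j * munit N k l) \<cdot>\<^sub>o f) m
      = (if m mod N = i then if j = k then coord f (m - i + l) else 0 else 0)"
    unfolding app_simps coord_munit by (cases "m mod N = i"; cases "j = k"; simp only: simp_thms if_True if_False)
  then show "coord ((munit N i j * munit N k l) \<cdot>\<^sub>o f) m
      = coord ((if j = k then munit N i l else 0) \<cdot>\<^sub>o f) m"
    by (simp add: coord_munit)
qed

lemma opm_refine: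
  assumes "0 < N" "0 < q"
  shows "opm N a = opm (N * q) (mat (N * q) (N * q)
    (\<lambda>(i, j). if i div N = j div N then a $$ (i mod N, j mod N) else 0))" (is "_ = opm _ ?a")
proof (intro bop_eqI ell2_eqI)
  fix f m
  define r where "r = m mod (N * q)"
  define d where "d = r div N"
  have r: "r < N * q" unfolding r_def using assms by simp
  have rm: "r mod N = m mod N" unfolding r_def by (simp add: mod_mult2_eq)
  have d: "d < q" unfolding d_def using r by (simp add: less_mult_imp_div_less mult.commute)
  have rd: "r = N * d + m mod N" unfolding d_def rm[symmetric] by simp
  have mr: "r \<le> m" unfolding r_def by simp
  have sub: "m - r + (N * d + j) = m - m mod N + j" for j
    using rd mr by linarith
  have jj: "(N * d + j) div N = d" "(N * d + j) mod N = j" if "j < N" for j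
    using that by auto
  have "coord (opm (N * q) ?a \<cdot>\<^sub>o f) m
      = (\<Sum>j<N * q. if d = j div N then a $$ (r mod N, j mod N) * coord f (m - r + j) else 0)"
    using assms r by (auto simp: coord_opm r_def[symmetric] d_def intro!: sum.cong)
  also have "\<dots> = (\<Sum>j\<in>{j. j < N * q \<and> d = j div N}. a $$ (r mod N, j mod N) * coord f (m - r + j))"
    by (intro sum.mono_neutral_cong_right) auto
  also have "\<dots> = (\<Sum>j<N. a $$ (r mod N, j) * coord f (m - m mod N + j))"
  proof (rule sum.reindex_bij_witness[where i = "\<lambda>j. N * d + j" and j = "\<lambda>j. j mod N"])
    fix j assume "j \<in> {j. j < N * q \<and> d = j div N}"
    then show "N * d + j mod N = j" "j mod N \<in> {..<N}" using assms by auto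
    then show "a $$ (r mod N, j mod N) * coord f (m - m mod N + j mod N)
        = a $$ (r mod N, j mod N) * coord f (m - r + j)"
      using sub[of "j mod N"] by simp
  next
    fix j assume "j \<in> {..<N}"
    then have j: "j < N" by simp
    have "N * d + j < N * (d + 1)" using j by simp
    also have "\<dots> \<le> N * q" using d by (intro mult_le_mono) auto
    finally show "N * d + j \<in> {j. j < N * q \<and> d = j div N}" using jj[OF j] by simp
    show "(N * d + j) mod N = j" using jj[OF j] by simp
  qed
  also have "\<dots> = coord (opm N a \<cdot>\<^sub>o f) m"
    using assms by (simp add: coord_opm rm)
  finally show "coord (opm N a \<cdot>\<^sub>o f) m = coord (opm (N * q) ?a \<cdot>\<^sub>o f) m" by simp
qed

lemma entry_opm_diag:
  assumes "0 < N" shows "entry (opm N a) i i = a $$ (i mod N, i mod N)"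
proof -
  have "entry (opm N a) i i = (\<Sum>j<N. if j = i mod N then a $$ (i mod N, i mod N) else 0)"
    unfolding entry_def coord_opm[OF assms]
  proof (rule sum.cong)
    fix j
    have "i - i mod N + j = i \<longleftrightarrow> j = i mod N"
      using mod_less_eq_dividend[of i N] by linarith
    then show "a $$ (i mod N, j) * coord (basis_vec i) (i - i mod N + j)
      = (if j = i mod N then a $$ (i mod N, i mod N) else 0)"
      by (auto simp: coord_basis_vec)
  qed simp
  then show ?thesis using assms by simp
qed

lemma entry_opm:
  assumes "i < N" "j < N" shows "entry (opm N a) i j = a $$ (i, j)"
proof -
  have "entry (opm N a) i j = (\<Sum>k<N. a $$ (i, k) * (if k = j then 1 else 0))"
    unfolding entry_def using assms by (simp add: coord_opm coord_basis_vec)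
  also have "\<dots> = a $$ (i, j)" using assms by (subst sum_single_term[of _ j]) auto
  finally show ?thesis .
qed

section \<open>UHF algebras\<close>

locale operator_star_algebra =
  fixes C :: "bop set"
  assumes one_mem: "1 \<in> C"
    and add_mem: "S \<in> C \<Longrightarrow> T \<in> C \<Longrightarrow> S + T \<in> C"
    and mult_mem: "S \<in> C \<Longrightarrow> T \<in> C \<Longrightarrow> S * T \<in> C"
    and csc_mem: "S \<in> C \<Longrightarrow> csc c * S \<in> C"
    and csc_commute: "S \<in> C \<Longrightarrow> S * csc c = csc c * S"
    and ex_adj: "S \<in> C \<Longrightarrow> \<exists>T\<in>C. is_adj S T"
begin

lemma scaleR_mem: "S \<in> C \<Longrightarrow> r *\<^sub>R S \<in> C"
  using csc_mem[of S "of_real r"] by (simp add: csc_of_real)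

lemma zero_mem: "0 \<in> C"
  using scaleR_mem[OF one_mem, of 0] by simp

lemma uminus_mem: "S \<in> C \<Longrightarrow> - S \<in> C"
  using scaleR_mem[of S "-1"] by simp

lemma diff_mem: "S \<in> C \<Longrightarrow> T \<in> C \<Longrightarrow> S - T \<in> C"
  using add_mem[of S "- T"] uminus_mem by simp

lemma power_mem: "S \<in> C \<Longrightarrow> S ^ n \<in> C"
  by (induction n) (auto intro: one_mem mult_mem)

lemma sum_mem: "(\<And>i. i \<in> I \<Longrightarrow> S i \<in> C) \<Longrightarrow> sum S I \<in> C"
  by (induction I rule: infinite_finite_induct) (auto intro: zero_mem add_mem)

lemma is_adj_adjoint: "S \<in> C \<Longrightarrow> is_adj S (adjoint S)"
  and adjoint_mem: "S \<in> C \<Longrightarrow> adjoint S \<in> C"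
  using ex_adj adjoint_eq by blast+

end

lemma operator_star_algebra_closure:
  assumes "operator_star_algebra D" shows "operator_star_algebra (closure D)"
proof -
  interpret operator_star_algebra D by fact
  show ?thesis
  proof
    show "1 \<in> closure D" using one_mem closure_subset by blast
    fix S T c
    assume S: "S \<in> closure D"
    then obtain X where X: "\<And>n. X n \<in> D" "X \<longlonglongrightarrow> S" by (auto simp: closure_sequential)
    show "csc c * S \<in> closure D"
      unfolding closure_sequential
      using X by (intro exI[of _ "\<lambda>n. csc c * X n"]) (auto intro: csc_mem tendsto_intros)
    show "S * csc c = csc c * S"
    proof (rule LIMSEQ_unique)
      show "(\<lambda>n. X n * csc c) \<longlonglongrightarrow> S * csc c" by (intro tendsto_intros X)
      have "(\<lambda>n. csc c * X n) \<longlonglongrightarrow> csc c * S" by (intro tendsto_intros X)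
      then show "(\<lambda>n. X n * csc c) \<longlonglongrightarrow> csc c * S" using csc_commute X(1) by simp
    qed
    have "\<forall>n. \<exists>T. T \<in> D \<and> is_adj (X n) T" using ex_adj[OF X(1)] by blast
    from choice[OF this] obtain Y where Y: "\<And>n. Y n \<in> D" "\<And>n. is_adj (X n) (Y n)" by blast
    obtain L where "Y \<longlonglongrightarrow> L" "is_adj S L" using is_adj_limit[OF X(2) Y(2)] .
    moreover from this have "L \<in> closure D" unfolding closure_sequential using Y(1) by blast
    ultimately show "\<exists>T\<in>closure D. is_adj S T" by blast
    assume "T \<in> closure D"
    then obtain Y where Y: "\<And>n. Y n \<in> D" "Y \<longlonglongrightarrow> T" by (auto simp: closure_sequential)
    show "S + T \<in> closure D"
      unfolding closure_sequential
      using X Y by (intro exI[of _ "\<lambda>n. X n + Y n"]) (auto intro: add_mem tendsto_add)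
    show "S * T \<in> closure D"
      unfolding closure_sequential
      using X Y by (intro exI[of _ "\<lambda>n. X n * Y n"]) (auto intro: mult_mem tendsto_mult)
  qed
qed

definition mat_ops :: "nat \<Rightarrow> bop set" where "mat_ops N = opm N ` carrier_mat N N"

lemma operator_star_algebra_mat_ops: assumes "0 < N" shows "operator_star_algebra (mat_ops N)"
proof
  show "1 \<in> mat_ops N"
    unfolding mat_ops_def using opm_one[OF assms] one_carrier_mat[of N] by (metis imageI)
  fix S T c assume "S \<in> mat_ops N"
  then obtain a where a: "a \<in> carrier_mat N N" "S = opm N a" by (auto simp: mat_ops_def)
  show "csc c * S \<in> mat_ops N" using a by (simp add: csc_opm mat_ops_def)
  show "S * csc c = csc c * S" using a by (simp add: opm_csc)
  show "\<exists>T\<in>mat_ops N. is_adj S T"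
    using a is_adj_opm[OF a(1)] mat_adjoint_carrier[OF a(1)] by (auto simp: mat_ops_def)
  assume "T \<in> mat_ops N"
  then obtain b where b: "b \<in> carrier_mat N N" "T = opm N b" by (auto simp: mat_ops_def)
  show "S + T \<in> mat_ops N" using a b by (simp add: opm_add mat_ops_def)
  show "S * T \<in> mat_ops N" using a b assms by (simp add: opm_mult mat_ops_def)
qed

lemma mat_ops_mono: "0 < N \<Longrightarrow> 0 < q \<Longrightarrow> mat_ops N \<subseteq> mat_ops (N * q)"
  unfolding mat_ops_def by (auto simp: opm_refine[of N q])

definition uhf_pre :: "nat \<Rightarrow> bop set" where "uhf_pre p = (\<Union>n. mat_ops (p ^ n))"

definition uhf :: "nat \<Rightarrow> bop set" where "uhf p = closure (uhf_pre p)"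

lemma mat_ops_power_mono:
  assumes "0 < (p::nat)" "m \<le> n" shows "mat_ops (p ^ m) \<subseteq> mat_ops (p ^ n)"
  using mat_ops_mono[of "p ^ m" "p ^ (n - m)"] assms by (simp add: power_add[symmetric])

lemma operator_star_algebra_uhf_pre: assumes "0 < p" shows "operator_star_algebra (uhf_pre p)"
proof
  have n: "operator_star_algebra (mat_ops (p ^ n))" for n
    by (rule operator_star_algebra_mat_ops) (simp add: assms)
  show "1 \<in> uhf_pre p"
    using operator_star_algebra.one_mem[OF n] by (auto simp: uhf_pre_def)
  fix S T c assume "S \<in> uhf_pre p"
  then obtain i where i: "S \<in> mat_ops (p ^ i)" by (auto simp: uhf_pre_def)
  show "csc c * S \<in> uhf_pre p"
    using operator_star_algebra.csc_mem[OF n i] by (auto simp: uhf_pre_def)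
  show "S * csc c = csc c * S" by (rule operator_star_algebra.csc_commute[OF n i])
  show "\<exists>T\<in>uhf_pre p. is_adj S T"
    using operator_star_algebra.ex_adj[OF n i] by (auto simp: uhf_pre_def)
  assume "T \<in> uhf_pre p"
  then obtain j where j: "T \<in> mat_ops (p ^ j)" by (auto simp: uhf_pre_def)
  have ST: "S \<in> mat_ops (p ^ (i + j))" "T \<in> mat_ops (p ^ (i + j))"
    using i j mat_ops_power_mono[OF assms, of i "i + j"] mat_ops_power_mono[OF assms, of j "i + j"] by auto
  then show "S + T \<in> uhf_pre p" "S * T \<in> uhf_pre p"
    using operator_star_algebra.add_mem[OF n ST] operator_star_algebra.mult_mem[OF n ST]
    unfolding uhf_pre_def by (auto simp del: UN_simps)
qed

lemma operator_star_algebra_uhf: "0 < p \<Longrightarrow> operator_star_algebra (uhf p)"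
  unfolding uhf_def by (intro operator_star_algebra_closure operator_star_algebra_uhf_pre)

lemma closed_uhf: "closed (uhf p)"
  by (simp add: uhf_def)

lemma mat_ops_subset_uhf: "mat_ops (p ^ n) \<subseteq> uhf p"
  unfolding uhf_def by (rule subset_trans[OF _ closure_subset]) (auto simp: uhf_pre_def)

lemma uhf_approx:
  assumes "S \<in> uhf p" "0 < e"
  obtains n T where "T \<in> mat_ops (p ^ n)" "norm (S - T) < e"
proof -
  have "\<exists>T\<in>uhf_pre p. dist T S < e" using assms by (simp add: uhf_def closure_approachable)
  then obtain T n where "T \<in> mat_ops (p ^ n)" "dist T S < e" by (auto simp: uhf_pre_def)
  then show ?thesis using that[of T n] by (simp add: dist_norm norm_minus_commute)
qed

section \<open>The trace\<close>

definition ntr :: "nat \<Rightarrow> bop \<Rightarrow> complex" where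
  "ntr N S = (\<Sum>i<N. entry S i i) / of_nat N"

lemma ntr_simps:
  "ntr N (S + T) = ntr N S + ntr N T" "ntr N (S - T) = ntr N S - ntr N T"
  "ntr N (csc c * S) = c * ntr N S"
  by (simp_all add: ntr_def sum.distrib sum_subtractf add_divide_distrib diff_divide_distrib
      sum_distrib_left[symmetric])

lemma ntr_one: "0 < N \<Longrightarrow> ntr N 1 = 1"
  by (simp add: ntr_def)

lemma norm_ntr_le: "cmod (ntr N S) \<le> norm S"
proof (cases "N = 0")
  case False
  have "cmod (\<Sum>i<N. entry S i i) \<le> (\<Sum>i<N. norm S)"
    by (rule order_trans[OF norm_sum]) (intro sum_mono norm_entry_le)
  then show ?thesis using False by (simp add: ntr_def norm_divide divide_le_eq mult.commute)
qed (simp add: ntr_def)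

lemma ntr_opm: "0 < N \<Longrightarrow> ntr N (opm N a) = (\<Sum>i<N. a $$ (i, i)) / of_nat N"
  unfolding ntr_def by (simp add: entry_opm_diag)

lemma ntr_refine:
  assumes "S \<in> mat_ops N" "0 < N" "0 < q" shows "ntr (N * q) S = ntr N S"
proof -
  from assms obtain a where a: "S = opm N a" by (auto simp: mat_ops_def)
  have "(\<Sum>i<N * q. a $$ (i mod N, i mod N)) = (\<Sum>m<q. \<Sum>i\<in>{m * N..<m * N + N}. a $$ (i mod N, i mod N))"
    by (simp add: sum.nat_group mult.commute)
  also have "\<dots> = (\<Sum>m<q. \<Sum>i<N. a $$ (i, i))"
  proof (rule sum.cong[OF refl])
    fix m
    show "(\<Sum>i\<in>{m * N..<m * N + N}. a $$ (i mod N, i mod N)) = (\<Sum>i<N. a $$ (i, i))"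
      using sum.shift_bounds_nat_ivl[of "\<lambda>i. a $$ (i mod N, i mod N)" 0 "m * N" N]
      by (simp add: add.commute atLeast0LessThan)
  qed
  finally show ?thesis
    using assms by (simp add: ntr_def a entry_opm_diag[OF assms(2)])
qed

lemma mat_trace_commute:
  fixes a b :: "complex mat"
  assumes "a \<in> carrier_mat N N" "b \<in> carrier_mat N N"
  shows "(\<Sum>i<N. (a * b) $$ (i, i)) = (\<Sum>i<N. (b * a) $$ (i, i))"
proof -
  have "(\<Sum>i<N. (a * b) $$ (i, i)) = (\<Sum>i<N. \<Sum>j<N. a $$ (i, j) * b $$ (j, i))"
    using assms by (intro sum.cong refl) (auto simp: scalar_prod_def atLeast0LessThan)
  also have "\<dots> = (\<Sum>i<N. \<Sum>j<N. b $$ (i, j) * a $$ (j, i))"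
    by (subst sum.swap) (simp add: mult.commute)
  also have "\<dots> = (\<Sum>i<N. (b * a) $$ (i, i))"
    using assms by (intro sum.cong refl) (auto simp: scalar_prod_def atLeast0LessThan)
  finally show ?thesis .
qed

lemma ntr_mult_commute:
  assumes "S \<in> mat_ops N" "T \<in> mat_ops N" "0 < N" shows "ntr N (S * T) = ntr N (T * S)"
proof -
  from assms obtain a b where "S = opm N a" "a \<in> carrier_mat N N" "T = opm N b" "b \<in> carrier_mat N N"
    by (auto simp: mat_ops_def)
  then show ?thesis using assms(3) mat_trace_commute[of a N b] by (simp add: opm_mult ntr_opm)
qed

lemma entry_adj_mult:
  assumes "is_adj S T" "\<And>c. S * csc c = csc c * S"
  shows "Im (entry (T * S) i i) = 0" "0 \<le> Re (entry (T * S) i i)"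
proof -
  have e: "inner c (entry (T * S) i i) = inner (S \<cdot>\<^sub>o cscale c (basis_vec i)) (S \<cdot>\<^sub>o basis_vec i)" for c
    using assms(1) inner_basis_vec[of c i "(T * S) \<cdot>\<^sub>o basis_vec i"]
    by (simp add: entry_def is_adj_def)
  have comm: "S \<cdot>\<^sub>o cscale c f = cscale c (S \<cdot>\<^sub>o f)" for c f
    using arg_cong[OF assms(2)[of c], of "\<lambda>X. X \<cdot>\<^sub>o f"] by simp
  show "0 \<le> Re (entry (T * S) i i)"
    using e[of 1] by (simp add: inner_complex_def)
  define g where "g = S \<cdot>\<^sub>o basis_vec i"
  have "inner (cscale \<i> g) g = inner g (cscale (- \<i>) g)" by (simp add: inner_cscale)
  also have "cscale (- \<i>) g = - cscale \<i> g" by (rule ell2_eqI) simp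
  finally have "inner (cscale \<i> g) g = 0" by (simp add: inner_commute)
  then show "Im (entry (T * S) i i) = 0"
    using e[of \<i>] unfolding comm g_def[symmetric] by (simp add: inner_complex_def)
qed

definition uhf_tr :: "nat \<Rightarrow> bop \<Rightarrow> complex" where
  "uhf_tr p S = lim (\<lambda>n. ntr (p ^ n) S)"

context
  fixes p :: nat
  assumes p: "0 < p"
begin

lemma ntr_stable:
  assumes "S \<in> mat_ops (p ^ m)" "m \<le> n" shows "ntr (p ^ n) S = ntr (p ^ m) S"
  using ntr_refine[OF assms(1), of "p ^ (n - m)"] p assms(2) by (simp add: power_add[symmetric])

lemma ntr_tendsto:
  assumes "S \<in> uhf p" shows "(\<lambda>n. ntr (p ^ n) S) \<longlonglongrightarrow> uhf_tr p S"
proof -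
  have "Cauchy (\<lambda>n. ntr (p ^ n) S)"
  proof (rule metric_CauchyI)
    fix e :: real assume "0 < e"
    then have "0 < e / 2" by simp
    from uhf_approx[OF assms this] obtain k T
      where T: "T \<in> mat_ops (p ^ k)" "norm (S - T) < e / 2" .
    have close: "cmod (ntr (p ^ n) S - ntr (p ^ k) T) < e / 2" if "n \<ge> k" for n
      using norm_ntr_le[of "p ^ n" "S - T"] T(2) ntr_stable[OF T(1) that]
      by (simp add: ntr_simps)
    have "dist (ntr (p ^ m) S) (ntr (p ^ n) S) < e" if "m \<ge> k" "n \<ge> k" for m n
      using dist_triangle_half_l[of "ntr (p ^ m) S" "ntr (p ^ k) T" e "ntr (p ^ n) S"]
        close[OF that(1)] close[OF that(2)] by (simp add: dist_norm)
    then show "\<exists>M. \<forall>m\<ge>M. \<forall>n\<ge>M. dist (ntr (p ^ m) S) (ntr (p ^ n) S) < e" by blast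
  qed
  then show ?thesis
    unfolding uhf_tr_def by (simp add: Cauchy_convergent_iff convergent_LIMSEQ_iff)
qed

lemma uhf_tr_mat_ops: assumes "S \<in> mat_ops (p ^ n)" shows "uhf_tr p S = ntr (p ^ n) S"
proof (rule LIMSEQ_unique[OF ntr_tendsto])
  show "S \<in> uhf p" using assms mat_ops_subset_uhf by blast
  have "\<forall>\<^sub>F k in sequentially. ntr (p ^ k) S = ntr (p ^ n) S"
    using eventually_ge_at_top[of n] by eventually_elim (rule ntr_stable[OF assms])
  then show "(\<lambda>k. ntr (p ^ k) S) \<longlonglongrightarrow> ntr (p ^ n) S" by (rule tendsto_eventually)
qed

interpretation U: operator_star_algebra "uhf p"
  by (rule operator_star_algebra_uhf[OF p])

lemma uhf_tr_add: "S \<in> uhf p \<Longrightarrow> T \<in> uhf p \<Longrightarrow> uhf_tr p (S + T) = uhf_tr p S + uhf_tr p T"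
  by (rule LIMSEQ_unique[OF ntr_tendsto]) (auto simp: ntr_simps intro: U.add_mem tendsto_add ntr_tendsto)

lemma uhf_tr_diff: "S \<in> uhf p \<Longrightarrow> T \<in> uhf p \<Longrightarrow> uhf_tr p (S - T) = uhf_tr p S - uhf_tr p T"
  by (rule LIMSEQ_unique[OF ntr_tendsto]) (auto simp: ntr_simps intro: U.diff_mem tendsto_diff ntr_tendsto)

lemma uhf_tr_csc: "S \<in> uhf p \<Longrightarrow> uhf_tr p (csc c * S) = c * uhf_tr p S"
  by (rule LIMSEQ_unique[OF ntr_tendsto]) (auto simp: ntr_simps intro: U.csc_mem tendsto_mult_left ntr_tendsto)

lemma uhf_tr_one: "uhf_tr p 1 = 1"
  by (rule LIMSEQ_unique[OF ntr_tendsto]) (auto simp: ntr_one p intro: U.one_mem)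

lemma norm_uhf_tr_le: "S \<in> uhf p \<Longrightarrow> cmod (uhf_tr p S) \<le> norm S"
  by (rule LIMSEQ_le_const2[OF tendsto_norm[OF ntr_tendsto]]) (auto intro: norm_ntr_le)

lemma uhf_tr_pos:
  assumes "S \<in> uhf p" "is_adj S T"
  shows "Im (uhf_tr p (T * S)) = 0" "0 \<le> Re (uhf_tr p (T * S))"
proof -
  have T: "T * S \<in> uhf p" using assms U.ex_adj is_adj_unique U.mult_mem by blast
  note e = entry_adj_mult[OF assms(2) U.csc_commute[OF assms(1)]]
  have "Im (ntr N (T * S)) = 0" "0 \<le> Re (ntr N (T * S))" for N
    by (auto simp: ntr_def Im_divide_of_nat Re_divide_of_nat e intro!: sum_nonneg divide_nonneg_nonneg)
  then show "Im (uhf_tr p (T * S)) = 0" "0 \<le> Re (uhf_tr p (T * S))"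
    using LIMSEQ_unique[OF tendsto_Im[OF ntr_tendsto[OF T]], of 0]
      LIMSEQ_le_const[OF tendsto_Re[OF ntr_tendsto[OF T]], of 0] by auto
qed

lemma uhf_tr_continuous:
  assumes "X \<longlonglongrightarrow> S" "\<And>n. X n \<in> uhf p" "S \<in> uhf p"
  shows "(\<lambda>n. uhf_tr p (X n)) \<longlonglongrightarrow> uhf_tr p S"
proof (rule LIM_zero_cancel, rule Lim_null_comparison)
  show "(\<lambda>n. norm (X n - S)) \<longlonglongrightarrow> 0" using assms(1) by (simp add: LIM_zero tendsto_norm_zero)
  show "\<forall>\<^sub>F n in sequentially. norm (uhf_tr p (X n) - uhf_tr p S) \<le> norm (X n - S)"
    using norm_uhf_tr_le[OF U.diff_mem[OF assms(2,3)]] uhf_tr_diff[OF assms(2,3)] by simp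
qed

lemma uhf_tr_commute:
  assumes "S \<in> uhf p" "T \<in> uhf p" shows "uhf_tr p (S * T) = uhf_tr p (T * S)"
proof -
  have pre: "uhf_pre p \<subseteq> uhf p" unfolding uhf_def by (rule closure_subset)
  from assms obtain X Y where X: "\<And>n. X n \<in> uhf_pre p" "X \<longlonglongrightarrow> S" and Y: "\<And>n. Y n \<in> uhf_pre p" "Y \<longlonglongrightarrow> T"
    by (auto simp: uhf_def closure_sequential)
  have mem: "X n \<in> uhf p" "Y n \<in> uhf p" for n using X(1) Y(1) pre by auto
  have eq: "uhf_tr p (X n * Y n) = uhf_tr p (Y n * X n)" for n
  proof -
    from X(1) Y(1) obtain i j where ij: "X n \<in> mat_ops (p ^ i)" "Y n \<in> mat_ops (p ^ j)"
      unfolding uhf_pre_def by blast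
    have m: "X n \<in> mat_ops (p ^ (i + j))" "Y n \<in> mat_ops (p ^ (i + j))"
      using ij mat_ops_power_mono[OF p, of i "i + j"] mat_ops_power_mono[OF p, of j "i + j"] by auto
    interpret M: operator_star_algebra "mat_ops (p ^ (i + j))"
      by (rule operator_star_algebra_mat_ops) (simp add: p)
    show ?thesis
      using ntr_mult_commute[OF m] p
      by (simp add: uhf_tr_mat_ops[OF M.mult_mem[OF m]] uhf_tr_mat_ops[OF M.mult_mem[OF m(2,1)]])
  qed
  show ?thesis
  proof (rule LIMSEQ_unique)
    show "(\<lambda>n. uhf_tr p (X n * Y n)) \<longlonglongrightarrow> uhf_tr p (S * T)"
      by (intro uhf_tr_continuous tendsto_mult X Y U.mult_mem mem assms)
    show "(\<lambda>n. uhf_tr p (X n * Y n)) \<longlonglongrightarrow> uhf_tr p (T * S)"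
      unfolding eq by (intro uhf_tr_continuous tendsto_mult X Y U.mult_mem mem assms)
  qed
qed

end

section \<open>Projections in UHF algebras\<close>

lemma closed_mat_ops: assumes "0 < N" shows "closed (mat_ops N)"
  unfolding closed_sequential_limits
proof (intro allI impI, elim conjE)
  fix X S assume X: "\<forall>n. X n \<in> mat_ops N" "X \<longlonglongrightarrow> S"
  define a where "a = mat N N (\<lambda>(i, j). entry S i j)"
  have "\<forall>n. \<exists>b. b \<in> carrier_mat N N \<and> X n = opm N b" using X(1) by (auto simp: mat_ops_def)
  from choice[OF this] obtain b where b: "\<And>n. b n \<in> carrier_mat N N" "\<And>n. X n = opm N (b n)" by blast
  have ent: "(\<lambda>n. b n $$ (i, j)) \<longlonglongrightarrow> a $$ (i, j)" if "i < N" "j < N" for i j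
  proof (rule LIM_zero_cancel, rule Lim_null_comparison)
    show "(\<lambda>n. norm (X n - S)) \<longlonglongrightarrow> 0" using X(2) by (simp add: LIM_zero tendsto_norm_zero)
    have "b n $$ (i, j) - a $$ (i, j) = entry (X n - S) i j" for n
      using that by (simp add: a_def b(2) entry_opm)
    then show "\<forall>\<^sub>F n in sequentially. norm (b n $$ (i, j) - a $$ (i, j)) \<le> norm (X n - S)"
      by (simp only: norm_entry_le eventually_True)
  qed
  have "X \<longlonglongrightarrow> opm N a"
  proof (rule LIM_zero_cancel, rule Lim_null_comparison)
    show "(\<lambda>n. \<Sum>i<N. \<Sum>j<N. cmod (b n $$ (i, j) - a $$ (i, j)) * norm (munit N i j)) \<longlonglongrightarrow> 0"
      by (intro tendsto_null_sum tendsto_mult_left_zero tendsto_norm_zero LIM_zero ent) auto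
    have "norm (X n - opm N a) \<le> (\<Sum>i<N. \<Sum>j<N. cmod (b n $$ (i, j) - a $$ (i, j)) * norm (munit N i j))" for n
    proof -
      have "csc (x - y) = csc x - csc y" for x y
        using csc_add[of "x - y" y] by (simp add: algebra_simps)
      then have "X n - opm N a = (\<Sum>i<N. \<Sum>j<N. csc (b n $$ (i, j) - a $$ (i, j)) * munit N i j)"
        unfolding b(2) opm_def by (simp add: left_diff_distrib sum_subtractf)
      also have "norm \<dots> \<le> (\<Sum>i<N. \<Sum>j<N. norm (csc (b n $$ (i, j) - a $$ (i, j)) * munit N i j))"
        by (rule order_trans[OF norm_sum]) (intro sum_mono norm_sum)
      finally show ?thesis by (simp add: norm_csc_mult)
    qed
    then show "\<forall>\<^sub>F n in sequentially. norm (X n - opm N a)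
        \<le> (\<Sum>i<N. \<Sum>j<N. cmod (b n $$ (i, j) - a $$ (i, j)) * norm (munit N i j))" by simp
  qed
  then have "S = opm N a" using X(2) LIMSEQ_unique by blast
  then show "S \<in> mat_ops N" by (auto simp: mat_ops_def a_def)
qed

text \<open>The Newton step \<open>x - (2 x - 1)\<^sup>-\<^sup>1 (x\<^sup>2 - x)\<close> for the equation \<open>x\<^sup>2 = x\<close>, with \<open>2 x - 1\<close>
  in place of its inverse, is \<open>3 x\<^sup>2 - 2 x\<^sup>3\<close>.\<close>

definition newton :: "bop \<Rightarrow> bop" where
  "newton x = x * x + x * x + x * x - x * x * x - x * x * x"

lemma newton_defect:
  "newton x * newton x - newton x =
    (x * x - x) * (x * x - x) * ((x * x - x) + (x * x - x) + (x * x - x) + (x * x - x) - 1 - 1 - 1)"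
  unfolding newton_def by (simp add: algebra_simps)

lemma newton_step: "newton x - x = - ((x + x - 1) * (x * x - x))"
  unfolding newton_def by (simp add: algebra_simps)

lemma newton_bounds:
  assumes "is_adj x x" "norm (x * x - x) \<le> 1 / 16"
  shows "is_adj (newton x) (newton x)"
    and "norm (newton x * newton x - newton x) \<le> norm (x * x - x) / 4"
    and "norm (newton x - x) \<le> 3 / 2 * norm (x * x - x)"
proof -
  define d where "d = x * x - x"
  have d: "norm d \<le> 1 / 16" using assms by (simp add: d_def)
  have xx: "is_adj (x * x) (x * x)" "is_adj (x * x * x) (x * x * x)"
    using is_adj_mult[OF assms(1) assms(1)] is_adj_mult[OF is_adj_mult[OF assms(1) assms(1)] assms(1)]
    by (simp_all add: mult.assoc)
  show "is_adj (newton x) (newton x)"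
    unfolding newton_def by (intro is_adj_diff is_adj_add xx)
  have n4: "norm (d + d + d + d) \<le> 4 * norm d"
    using norm_triangle_ineq[of "d + d + d" d] norm_triangle_ineq[of "d + d" d]
      norm_triangle_ineq[of d d] by linarith
  have "norm (d + d + d + d - 1 - 1 - 1) \<le> norm (d + d + d + d) + 1 + 1 + 1"
    using norm_triangle_ineq4[of "d + d + d + d - 1 - 1" 1] norm_triangle_ineq4[of "d + d + d + d - 1" 1]
      norm_triangle_ineq4[of "d + d + d + d" 1] norm_one[where 'a = bop] by linarith
  then have k: "norm (d + d + d + d - 1 - 1 - 1) \<le> 4" using n4 d by linarith
  have "norm (newton x * newton x - newton x) \<le> norm d * norm d * norm (d + d + d + d - 1 - 1 - 1)"
    unfolding newton_defect d_def[symmetric]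
    by (rule order_trans[OF norm_mult_ineq mult_right_mono[OF norm_mult_ineq norm_ge_zero]])
  also have "\<dots> \<le> norm d * (1 / 16) * 4"
    using d k by (intro mult_mono mult_left_mono mult_nonneg_nonneg) auto
  finally show "norm (newton x * newton x - newton x) \<le> norm (x * x - x) / 4"
    by (simp add: d_def)
  define s where "s = x + x - 1"
  have s: "is_adj s s" unfolding s_def by (intro is_adj_diff is_adj_add assms is_adj_one)
  have "s * s = 1 + (d + d + d + d)" unfolding s_def d_def by (simp add: algebra_simps)
  then have "norm (s * s) \<le> 1 + 4 * norm d"
    using norm_triangle_ineq[of 1 "d + d + d + d"] n4 by simp
  then have "(norm s)\<^sup>2 \<le> (3 / 2)\<^sup>2"
    using is_adj_cstar[OF s] d by (simp add: power2_eq_square)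
  then have "norm s \<le> 3 / 2" by (rule power2_le_imp_le) simp
  then have "norm s * norm d \<le> 3 / 2 * norm d" by (intro mult_right_mono) auto
  moreover have "norm (newton x - x) \<le> norm s * norm d"
    unfolding newton_step norm_minus_cancel s_def d_def by (rule norm_mult_ineq)
  ultimately show "norm (newton x - x) \<le> 3 / 2 * norm (x * x - x)" by (simp add: d_def)
qed

lemma near_projection:
  assumes "operator_star_algebra C" "closed C" "x \<in> C" "is_adj x x" "norm (x * x - x) \<le> 1 / 16"
  obtains f where "f \<in> C" "is_adj f f" "f * f = f" "norm (f - x) \<le> 2 * norm (x * x - x)"
proof -
  interpret operator_star_algebra C by fact
  define X where "X n = (newton ^^ n) x" for n
  define d where "d = norm (x * x - x)"
  have X0: "X 0 = x" and XS: "X (Suc n) = newton (X n)" for n by (simp_all add: X_def)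
  have X: "X n \<in> C \<and> is_adj (X n) (X n) \<and> norm (X n * X n - X n) \<le> d * (1 / 4) ^ n" for n
  proof (induction n)
    case 0
    show ?case using assms by (simp add: X0 d_def)
  next
    case (Suc n)
    have "d * (1 / 4) ^ n \<le> 1 / 16 * 1"
      using assms(5) by (intro mult_mono) (auto simp: d_def power_le_one)
    then have small: "norm (X n * X n - X n) \<le> 1 / 16" using Suc by linarith
    have "newton (X n) \<in> C" unfolding newton_def using Suc by (intro diff_mem add_mem mult_mem) auto
    moreover have "norm (newton (X n) * newton (X n) - newton (X n)) \<le> d * (1 / 4) ^ Suc n"
      using newton_bounds(2)[OF _ small] Suc by simp
    ultimately show ?case using newton_bounds(1)[OF _ small] Suc by (simp add: XS)
  qed
  have step: "norm (X (Suc n) - X n) \<le> 3 / 2 * d * (1 / 4) ^ n" for n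
  proof -
    have "d * (1 / 4) ^ n \<le> 1 / 16 * 1"
      using assms(5) by (intro mult_mono) (auto simp: d_def power_le_one)
    then have small: "norm (X n * X n - X n) \<le> 1 / 16" using X[of n] by linarith
    have "norm (newton (X n) - X n) \<le> 3 / 2 * norm (X n * X n - X n)"
      using newton_bounds(3)[OF _ small] X by simp
    also have "\<dots> \<le> 3 / 2 * (d * (1 / 4) ^ n)" using X[of n] by (intro mult_left_mono) auto
    finally show ?thesis by (simp add: XS)
  qed
  have geo: "(\<lambda>n. 3 / 2 * d * (1 / 4) ^ n) sums (2 * d)"
    using sums_mult[OF geometric_sums[of "1 / 4 :: real"], of "3 / 2 * d"] by simp
  have sn: "summable (\<lambda>n. norm (X (Suc n) - X n))"
    by (rule summable_comparison_test'[OF sums_summable[OF geo], of 0]) (use step in simp)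
  have "(\<lambda>n. \<Sum>k<n. X (Suc k) - X k) \<longlonglongrightarrow> (\<Sum>k. X (Suc k) - X k)"
    using summable_norm_cancel[OF sn] by (rule summable_LIMSEQ)
  then have "(\<lambda>n. X n - X 0) \<longlonglongrightarrow> (\<Sum>k. X (Suc k) - X k)" by (simp only: sum_lessThan_telescope)
  from tendsto_add[OF this tendsto_const[of "X 0"]]
  have lim: "X \<longlonglongrightarrow> (\<Sum>k. X (Suc k) - X k) + x" by (simp add: X0)
  define f where "f = (\<Sum>k. X (Suc k) - X k) + x"
  have lim: "X \<longlonglongrightarrow> f" unfolding f_def by (rule lim)
  show ?thesis
  proof
    show "f \<in> C" using closed_sequentially[OF assms(2) _ lim] X by blast
    obtain T where "X \<longlonglongrightarrow> T" "is_adj f T" using is_adj_limit[OF lim, of X] X by blast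
    then show "is_adj f f" using LIMSEQ_unique[OF lim] by blast
    have "(\<lambda>n. X n * X n - X n) \<longlonglongrightarrow> 0"
    proof (rule Lim_null_comparison)
      show "\<forall>\<^sub>F n in sequentially. norm (X n * X n - X n) \<le> d * (1 / 4) ^ n" using X by simp
      show "(\<lambda>n. d * (1 / 4) ^ n) \<longlonglongrightarrow> 0"
        by (intro tendsto_mult_right_zero LIMSEQ_power_zero) simp
    qed
    moreover have "(\<lambda>n. X n * X n - X n) \<longlonglongrightarrow> f * f - f" by (intro tendsto_intros lim)
    ultimately have "f * f - f = 0" using LIMSEQ_unique by blast
    then show "f * f = f" by simp
    have "norm (f - x) \<le> (\<Sum>k. norm (X (Suc k) - X k))"
      unfolding f_def using summable_norm[OF sn] by simp
    also have "\<dots> \<le> (\<Sum>k. 3 / 2 * d * (1 / 4) ^ k)"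
      by (rule suminf_le[OF step sn sums_summable[OF geo]])
    also have "\<dots> = 2 * d" by (rule sums_unique[OF geo, symmetric])
    finally show "norm (f - x) \<le> 2 * norm (x * x - x)" by (simp add: d_def)
  qed
qed

lemma norm_projection_le: assumes "is_adj e e" "e * e = e" shows "norm e \<le> 1"
proof -
  have "norm e * norm e = norm e" using is_adj_cstar[OF assms(1)] assms(2) by (simp add: power2_eq_square)
  then show ?thesis by (cases "norm e = 0") auto
qed

lemma uhf_approx_self_adjoint:
  assumes "0 < p" "S \<in> uhf p" "is_adj S S" "0 < r"
  obtains n T where "T \<in> mat_ops (p ^ n)" "is_adj T T" "norm (S - T) < r"
proof -
  obtain n T where T: "T \<in> mat_ops (p ^ n)" "norm (S - T) < r" using uhf_approx[OF assms(2,4)] .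
  interpret M: operator_star_algebra "mat_ops (p ^ n)"
    by (rule operator_star_algebra_mat_ops) (simp add: assms)
  obtain T' where T': "T' \<in> mat_ops (p ^ n)" "is_adj T T'" using M.ex_adj[OF T(1)] by blast
  define R where "R = (1 / 2) *\<^sub>R (T + T')"
  have a: "is_adj (S - T) (S - T')" by (rule is_adj_diff[OF assms(3) T'(2)])
  have "R \<in> mat_ops (p ^ n)" unfolding R_def by (intro M.scaleR_mem M.add_mem T T')
  moreover have "is_adj R R"
    unfolding R_def using is_adj_scaleR[OF is_adj_add[OF T'(2) is_adj_sym[OF T'(2)]]] by (simp add: add.commute)
  moreover have "norm (S - R) < r"
  proof -
    have "S - R = (1 / 2) *\<^sub>R ((S - T) + (S - T'))"
      unfolding R_def by (simp add: algebra_simps scaleR_add_left[symmetric])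
    then have "norm (S - R) \<le> (1 / 2) * (norm (S - T) + norm (S - T'))"
      using norm_triangle_ineq[of "S - T" "S - T'"] by simp
    then show ?thesis using is_adj_norm[OF a] T(2) by simp
  qed
  ultimately show ?thesis using that by blast
qed

lemma uhf_near_projection:
  assumes "0 < p" "e \<in> uhf p" "is_adj e e" "e * e = e"
  obtains n f where "f \<in> mat_ops (p ^ n)" "is_adj f f" "f * f = f" "norm (e - f) < 1 / 3"
proof -
  have "(0::real) < 1 / 100" by simp
  from uhf_approx_self_adjoint[OF assms(1-3) this] obtain n x
    where x: "x \<in> mat_ops (p ^ n)" "is_adj x x" "norm (e - x) < 1 / 100" .
  define y where "y = x - e"
  have y: "norm y < 1 / 100" using x(3) by (simp add: y_def norm_minus_commute)
  have "x * x - x = y * y + y * e + e * y - y"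
    using assms(4) by (simp add: y_def algebra_simps)
  also have "norm \<dots> \<le> norm y * norm y + norm y * norm e + norm e * norm y + norm y"
    by (intro order_trans[OF norm_triangle_ineq4] order_trans[OF norm_triangle_ineq] add_mono norm_mult_ineq order_refl)
  also have "\<dots> \<le> norm y * 1 + norm y * 1 + 1 * norm y + norm y"
    using y norm_projection_le[OF assms(3,4)] by (intro add_mono mult_mono) auto
  finally have d: "norm (x * x - x) \<le> 4 / 100" using y by linarith
  have N: "0 < p ^ n" using assms(1) by simp
  obtain f where f: "f \<in> mat_ops (p ^ n)" "is_adj f f" "f * f = f" "norm (f - x) \<le> 2 * norm (x * x - x)"
    by (rule near_projection[OF operator_star_algebra_mat_ops[OF N] closed_mat_ops[OF N] x(1,2)]) (use d in auto)
  have "norm (e - f) \<le> norm (e - x) + norm (f - x)"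
    using norm_triangle_ineq4[of "e - x" "f - x"] by simp
  then have "norm (e - f) < 1 / 3" using x(3) f(4) d by linarith
  with f show ?thesis using that by blast
qed

lemma neumann_inverse:
  assumes "operator_star_algebra C" "closed C" "w \<in> C" "norm (1 - w) < 1"
  obtains v where "v \<in> C" "w * v = 1" "v * w = 1"
proof -
  interpret operator_star_algebra C by fact
  define u where "u = 1 - w"
  define v where "v = (\<Sum>n. u ^ n)"
  have u: "u \<in> C" unfolding u_def by (intro diff_mem one_mem assms)
  have s: "summable (\<lambda>n. u ^ n)" using assms(4) by (simp add: u_def complete_algebra_summable_geometric)
  have lim: "(\<lambda>n. \<Sum>k<n. u ^ k) \<longlonglongrightarrow> v" unfolding v_def by (rule summable_LIMSEQ[OF s])
  have un: "(\<lambda>n. u ^ n) \<longlonglongrightarrow> 0" by (rule summable_LIMSEQ_zero[OF s])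
  have w: "w = 1 - u" by (simp add: u_def)
  have wu: "w * u ^ n = u ^ n - u ^ Suc n" "u ^ n * w = u ^ n - u ^ Suc n" for n
    by (simp_all add: w left_diff_distrib right_diff_distrib power_commutes)
  have l: "w * (\<Sum>k<n. u ^ k) = 1 - u ^ n" and r: "(\<Sum>k<n. u ^ k) * w = 1 - u ^ n" for n
    by (induction n) (simp_all add: distrib_left distrib_right wu del: power_Suc)
  show ?thesis
  proof
    show "v \<in> C"
      by (rule closed_sequentially[OF assms(2) _ lim]) (intro sum_mem power_mem u)
    show "w * v = 1"
      using LIMSEQ_unique[OF tendsto_mult_left[OF lim, of w]] tendsto_diff[OF tendsto_const un, of 1]
      by (simp add: l)
    show "v * w = 1"
      using LIMSEQ_unique[OF tendsto_mult_right[OF lim, of w]] tendsto_diff[OF tendsto_const un, of 1]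
      by (simp add: r)
  qed
qed

lemma near_projections_similar:
  assumes "operator_star_algebra C" "closed C" "e \<in> C" "f \<in> C"
    "is_adj f f" "e * e = e" "f * f = f" "norm (e - f) < 1 / 3"
  obtains v w where "v \<in> C" "w \<in> C" "w * v = 1" "e = v * (f * w)"
proof -
  interpret operator_star_algebra C by fact
  define w where "w = f * e + (1 - f) * (1 - e)"
  have w: "w \<in> C" unfolding w_def by (intro add_mem mult_mem diff_mem one_mem assms)
  have "1 - w = f * (f - e) + (1 - f) * (e - f)"
    using assms(6,7) by (simp add: w_def algebra_simps)
  also have "norm \<dots> \<le> norm f * norm (e - f) + norm (1 - f) * norm (e - f)"
    by (rule order_trans[OF norm_triangle_ineq add_mono[OF order_trans[OF norm_mult_ineq] norm_mult_ineq]])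
       (simp add: norm_minus_commute)
  also have "\<dots> \<le> 1 * norm (e - f) + 2 * norm (e - f)"
    using norm_triangle_ineq4[of 1 f] norm_projection_le[OF assms(5,7)]
    by (intro add_mono mult_right_mono) auto
  also have "\<dots> < 1" using assms(8) by linarith
  finally obtain v where v: "v \<in> C" "w * v = 1" "v * w = 1"
    using neumann_inverse[OF assms(1,2) w] by blast
  have "f * w = w * e" using assms(6,7) by (simp add: w_def algebra_simps mult.assoc[symmetric])
  then have "v * (f * w) = e" using v(3) by (simp add: mult.assoc[symmetric])
  with v w show ?thesis using that by blast
qed

section \<open>Traces of projection matrices\<close>

lemma idempotent_mat_trace:
  fixes a :: "complex mat"
  assumes a: "a \<in> carrier_mat N N" and "a * a = a"
  obtains k :: nat where "(\<Sum>i<N. a $$ (i, i)) = of_nat k"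
proof -
  obtain es where "char_poly a = (\<Prod>e\<leftarrow>es. [:- e, 1:])"
    using char_poly_factorized[OF a] by blast
  from schur_decomposition_exists[OF a this] obtain b
    where b: "b \<in> carrier_mat N N" "upper_triangular b" "similar_mat a b" by blast
  then obtain P Q where "similar_mat_wit a b P Q" by (auto simp: similar_mat_def)
  note w = similar_mat_witD2[OF a this]
  have PQ: "P \<in> carrier_mat N N" "Q \<in> carrier_mat N N" by (fact w)+
  have b_eq: "b = Q * a * P"
  proof -
    have "Q * a * P = Q * (P * b * Q) * P" using w(3) by simp
    also have "\<dots> = (Q * P) * b * (Q * P)"
      using PQ b(1) by (simp add: assoc_mult_mat[of _ N N _ N _ N])
    also have "\<dots> = b" using w(2) b(1) by simp
    finally show ?thesis by simp
  qed
  have bb: "b * b = b"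
  proof -
    have "b * b = Q * a * (P * Q) * a * P"
      unfolding b_eq using PQ a by (simp add: assoc_mult_mat[of _ N N _ N _ N])
    also have "\<dots> = Q * (a * a) * P"
      using PQ a w(1) by (simp add: assoc_mult_mat[of _ N N _ N _ N])
    finally show ?thesis using assms(2) b_eq by simp
  qed
  have diag: "b $$ (i, i) = 0 \<or> b $$ (i, i) = 1" if i: "i < N" for i
  proof -
    have "b $$ (i, i) = (\<Sum>j<N. b $$ (i, j) * b $$ (j, i))"
      by (subst bb[symmetric]) (use b(1) i in \<open>auto simp: scalar_prod_def atLeast0LessThan intro!: sum.cong\<close>)
    also have "\<dots> = b $$ (i, i) * b $$ (i, i)"
    proof (rule sum_single_term)
      fix j assume "j \<in> {..<N}" "j \<noteq> i"
      then have "b $$ (i, j) = 0 \<or> b $$ (j, i) = 0"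
        using upper_triangularD[OF b(2)] b(1) i by (cases "j < i") auto
      then show "b $$ (i, j) * b $$ (j, i) = 0" by auto
    qed (use i in auto)
    finally show ?thesis by simp
  qed
  have "(\<Sum>i<N. a $$ (i, i)) = (\<Sum>i<N. (P * (b * Q)) $$ (i, i))"
    using w(3) PQ b(1) by (simp add: assoc_mult_mat[of _ N N _ N _ N])
  also have "\<dots> = (\<Sum>i<N. (b * Q * P) $$ (i, i))"
    by (rule mat_trace_commute) (use PQ b(1) in auto)
  also have "b * Q * P = b"
    using PQ b(1) w(2) by (simp add: assoc_mult_mat[of _ N N _ N _ N])
  also have "(\<Sum>i<N. b $$ (i, i)) = (\<Sum>i<N. of_nat (if b $$ (i, i) = 0 then 0 else 1))"
    using diag by (intro sum.cong refl) auto
  finally show ?thesis using that by (simp only: of_nat_sum[symmetric])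
qed

lemma projection_mat_trace:
  fixes a :: "complex mat"
  assumes a: "a \<in> carrier_mat N N" and "a * a = a" "mat_adjoint a = a"
  obtains k :: nat where "(\<Sum>i<N. a $$ (i, i)) = of_nat k" "k = 0 \<Longrightarrow> a = 0\<^sub>m N N"
proof -
  obtain k :: nat where k: "(\<Sum>i<N. a $$ (i, i)) = of_nat k"
    using idempotent_mat_trace[OF a assms(2)] by blast
  have adj: "a $$ (j, i) = cnj (a $$ (i, j))" if "i < N" "j < N" for i j
    using mat_adjoint_index[OF a that(2,1)] assms(3) by simp
  have "of_nat k = (\<Sum>i<N. (a * a) $$ (i, i))" using k assms(2) by simp
  also have "\<dots> = (\<Sum>i<N. \<Sum>j<N. a $$ (i, j) * a $$ (j, i))"
    using a by (intro sum.cong refl) (auto simp: scalar_prod_def atLeast0LessThan)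
  also have "\<dots> = (\<Sum>i<N. \<Sum>j<N. complex_of_real ((cmod (a $$ (i, j)))\<^sup>2))"
  proof (intro sum.cong refl)
    fix i j assume "i \<in> {..<N}" "j \<in> {..<N}"
    then show "a $$ (i, j) * a $$ (j, i) = complex_of_real ((cmod (a $$ (i, j)))\<^sup>2)"
      by (subst adj[of i j]) (simp_all only: lessThan_iff complex_norm_square)
  qed
  also have "\<dots> = complex_of_real (\<Sum>i<N. \<Sum>j<N. (cmod (a $$ (i, j)))\<^sup>2)"
    by (simp only: of_real_sum)
  finally have "complex_of_real (of_nat k) = complex_of_real (\<Sum>i<N. \<Sum>j<N. (cmod (a $$ (i, j)))\<^sup>2)"
    by (simp only: of_real_of_nat_eq)
  then have s: "of_nat k = (\<Sum>i<N. \<Sum>j<N. (cmod (a $$ (i, j)))\<^sup>2)"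
    by (simp only: of_real_eq_iff)
  have "a = 0\<^sub>m N N" if "k = 0"
  proof (rule eq_matI)
    fix i j assume "i < dim_row (0\<^sub>m N N :: complex mat)" "j < dim_col (0\<^sub>m N N :: complex mat)"
    then have ij: "i < N" "j < N" by auto
    have "(\<Sum>j<N. (cmod (a $$ (i, j)))\<^sup>2) = 0"
      using s that ij by (simp add: sum_nonneg_eq_0_iff sum_nonneg)
    then show "a $$ (i, j) = 0\<^sub>m N N $$ (i, j)" using ij by (simp add: sum_nonneg_eq_0_iff)
  qed (use a in auto)
  with k show ?thesis using that by blast
qed

lemma opm_inj:
  assumes "a \<in> carrier_mat N N" "b \<in> carrier_mat N N" "opm N a = opm N b" shows "a = b"
proof (rule eq_matI)
  fix i j assume "i < dim_row b" "j < dim_col b"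
  then show "a $$ (i, j) = b $$ (i, j)"
    using assms entry_opm[of i N j a] entry_opm[of i N j b] by auto
qed (use assms in auto)

lemma uhf_projection_trace:
  assumes "0 < p" "e \<in> uhf p" "is_adj e e" "e * e = e"
  obtains k n :: nat where "uhf_tr p e = of_nat k / of_nat (p ^ n)" "k = 0 \<Longrightarrow> e = 0"
proof -
  obtain n f where f: "f \<in> mat_ops (p ^ n)" "is_adj f f" "f * f = f" "norm (e - f) < 1 / 3"
    using uhf_near_projection[OF assms] by blast
  define N where "N = p ^ n"
  have N: "0 < N" using assms(1) by (simp add: N_def)
  obtain a where a: "a \<in> carrier_mat N N" "f = opm N a" using f(1) by (auto simp: mat_ops_def N_def)
  have "a * a = a" using f(3) a N by (intro opm_inj[of _ N]) (auto simp: opm_mult)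
  moreover have "mat_adjoint a = a"
    using is_adj_unique[OF is_adj_opm[OF a(1)]] f(2) a by (intro opm_inj[of _ N] mat_adjoint_carrier) auto
  ultimately obtain k :: nat where k: "(\<Sum>i<N. a $$ (i, i)) = of_nat k" "k = 0 \<Longrightarrow> a = 0\<^sub>m N N"
    using projection_mat_trace[OF a(1)] by blast
  interpret U: operator_star_algebra "uhf p" by (rule operator_star_algebra_uhf[OF assms(1)])
  have fU: "f \<in> uhf p" using f(1) mat_ops_subset_uhf by blast
  obtain v w where vw: "v \<in> uhf p" "w \<in> uhf p" "w * v = 1" "e = v * (f * w)"
    using near_projections_similar[OF U.operator_star_algebra_axioms closed_uhf assms(2) fU f(2) assms(4) f(3,4)]
    by blast
  have "uhf_tr p e = uhf_tr p (f * w * v)"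
    unfolding vw(4) by (intro uhf_tr_commute[OF assms(1)] U.mult_mem vw fU)
  also have "\<dots> = ntr N f"
    using vw(3) uhf_tr_mat_ops[OF assms(1) f(1)] by (simp add: mult.assoc N_def)
  also have "\<dots> = of_nat k / of_nat N" using N k(1) by (simp add: a(2) ntr_opm)
  finally have 1: "uhf_tr p e = of_nat k / of_nat (p ^ n)" unfolding N_def .
  have "e = 0" if "k = 0"
  proof -
    have "f = 0" using k(2)[OF that] by (simp add: a(2) opm_def)
    then show ?thesis using vw(4) by simp
  qed
  with 1 show ?thesis using that by blast
qed

lemma uhf_real_rank_zero:
  assumes "0 < p" "S \<in> uhf p" "is_adj S S" "0 < r"
  obtains T V where "T \<in> uhf p" "is_adj T T" "V \<in> uhf p" "T * V = 1" "V * T = 1" "norm (S - T) < r"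
proof -
  have "0 < r / 2" using assms(4) by simp
  from uhf_approx_self_adjoint[OF assms(1-3) this] obtain n R
    where R: "R \<in> mat_ops (p ^ n)" "is_adj R R" "norm (S - R) < r / 2" .
  define N where "N = p ^ n"
  have N: "0 < N" using assms(1) by (simp add: N_def)
  obtain a where a: "a \<in> carrier_mat N N" "R = opm N a" using R(1) by (auto simp: mat_ops_def N_def)
  have "char_poly a \<noteq> 0" using degree_monic_char_poly[OF a(1)] by auto
  then have "finite {x. poly (char_poly a) x = 0}" by (rule poly_roots_finite)
  then have "finite ((\<lambda>t. - complex_of_real t) -` {x. poly (char_poly a) x = 0})"
    by (rule finite_vimageI) (auto simp: inj_on_def)
  moreover have "infinite {0<..<r / 2}" using assms(4) by (simp add: infinite_Ioo)
  ultimately have "\<not> {0<..<r / 2} \<subseteq> (\<lambda>t. - complex_of_real t) -` {x. poly (char_poly a) x = 0}"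
    using finite_subset by blast
  then obtain t where t: "t \<in> {0<..<r / 2}" "poly (char_poly a) (- complex_of_real t) \<noteq> 0"
    by blast
  define b where "b = char_matrix a (- complex_of_real t)"
  have b: "b \<in> carrier_mat N N" using a(1) by (simp add: b_def)
  have "det b \<noteq> 0"
    using t(2) eigenvalue_root_char_poly[OF a(1)] eigenvalue_det[OF a(1)] by (simp add: b_def)
  from det_non_zero_imp_unit[OF b this, of "()"] obtain c
    where c: "c \<in> carrier_mat N N" "b * c = 1\<^sub>m N" "c * b = 1\<^sub>m N"
    by (auto simp: Units_def ring_mat_def)
  have "opm N b = R + opm N (complex_of_real t \<cdot>\<^sub>m 1\<^sub>m N)"
    using a by (simp add: b_def char_matrix_def opm_add)
  also have "opm N (complex_of_real t \<cdot>\<^sub>m 1\<^sub>m N) = t *\<^sub>R 1"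
    by (simp add: csc_opm[symmetric] opm_one[OF N] csc_of_real)
  finally have T: "opm N b = R + t *\<^sub>R 1" .
  show ?thesis
  proof
    have U: "opm N x \<in> uhf p" if "x \<in> carrier_mat N N" for x
      using that mat_ops_subset_uhf[of p n] by (auto simp: mat_ops_def N_def)
    show "opm N b \<in> uhf p" "opm N c \<in> uhf p" by (intro U b c)+
    show "opm N b * opm N c = 1" "opm N c * opm N b = 1"
      using opm_mult[OF N b c(1)] opm_mult[OF N c(1) b] c opm_one[OF N] by auto
    show "is_adj (opm N b) (opm N b)"
      unfolding T by (intro is_adj_add is_adj_scaleR is_adj_one R)
    have "norm (S - opm N b) \<le> norm (S - R) + norm (t *\<^sub>R (1::bop))"
      unfolding T using norm_triangle_ineq4[of "S - R" "t *\<^sub>R 1"] by (simp add: algebra_simps)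
    then show "norm (S - opm N b) < r" using R(3) t(1) by simp
  qed
qed

lemma munit_sum: assumes "0 < N" shows "(\<Sum>i<N. munit N i i) = 1"
proof (intro bop_eqI ell2_eqI)
  fix f m
  have "coord ((\<Sum>i<N. munit N i i) \<cdot>\<^sub>o f) m = (\<Sum>i<N. if m mod N = i then coord f (m - i + i) else 0)"
    by (simp add: app_sum coord_sum coord_munit)
  also have "\<dots> = coord f m" using assms by (subst sum_single_term[of _ "m mod N"]) auto
  finally show "coord ((\<Sum>i<N. munit N i i) \<cdot>\<^sub>o f) m = coord (1 \<cdot>\<^sub>o f) m" by simp
qed

text \<open>The images of the \<open>p^n\<close> diagonal matrix units are non-zero projections with the same trace,
  so the trace of the image of \<open>1\<close> is at least \<open>p^n\<close>, for every \<open>n\<close>.\<close>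

lemma uhf_no_findim_rep:
  fixes k :: "bop \<Rightarrow> complex mat"
  assumes "1 < p"
    and closed: "\<And>S. S \<in> uhf p \<Longrightarrow> k S \<in> carrier_mat d d"
    and add: "\<And>S T. S \<in> uhf p \<Longrightarrow> T \<in> uhf p \<Longrightarrow> k (S + T) = k S + k T"
    and mult: "\<And>S T. S \<in> uhf p \<Longrightarrow> T \<in> uhf p \<Longrightarrow> k (S * T) = k S * k T"
    and adj: "\<And>S T. S \<in> uhf p \<Longrightarrow> is_adj S T \<Longrightarrow> k T = mat_adjoint (k S)"
    and S: "S \<in> uhf p"
  shows "k S = 0\<^sub>m d d"
proof -
  have p: "0 < p" using assms(1) by simp
  interpret U: operator_star_algebra "uhf p" by (rule operator_star_algebra_uhf[OF p])
  define t where "t S = (\<Sum>l<d. k S $$ (l, l))" for S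
  have t_add: "t (S + T) = t S + t T" if "S \<in> uhf p" "T \<in> uhf p" for S T
    using closed[OF that(1)] closed[OF that(2)] by (simp add: t_def add[OF that] sum.distrib)
  have t_zero: "t 0 = 0" using t_add[OF U.zero_mem U.zero_mem] by simp
  have t_sum: "t (\<Sum>i<n. X i) = (\<Sum>i<n. t (X i))" if "\<And>i. i < n \<Longrightarrow> X i \<in> uhf p" for n :: nat and X
    using that
  proof (induction n)
    case (Suc n)
    have "(\<Sum>i<n. X i) \<in> uhf p" using Suc.prems by (intro U.sum_mem) auto
    then show ?case using Suc by (simp add: t_add)
  qed (simp add: t_zero)
  have t_proj: "\<exists>m::nat. t e = of_nat m \<and> (m = 0 \<longrightarrow> k e = 0\<^sub>m d d)"
    if e: "e \<in> uhf p" "is_adj e e" "e * e = e" for e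
  proof -
    have "k e * k e = k e" using mult[OF e(1) e(1)] e(3) by simp
    moreover have "mat_adjoint (k e) = k e" using adj[OF e(1,2)] by simp
    ultimately show ?thesis unfolding t_def using projection_mat_trace[OF closed[OF e(1)]] by blast
  qed
  have one: "is_adj 1 1" "1 * 1 = (1::bop)" by (auto intro: is_adj_one)
  obtain K :: nat where K: "t 1 = of_nat K" "K = 0 \<Longrightarrow> k 1 = 0\<^sub>m d d"
    using t_proj[OF U.one_mem one] by blast
  have "K = 0"
  proof (rule ccontr)
    assume K0: "K \<noteq> 0"
    define N where "N = p ^ K"
    have KN: "K < N" unfolding N_def using power_gt_expt[of p K] assms(1) by simp
    then have N: "0 < N" by simp
    have E: "munit N i j \<in> uhf p" if "i < N" "j < N" for i j
      using munit_eq_opm[OF that] mat_ops_subset_uhf[of p K]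
      by (auto simp: mat_ops_def N_def)
    have same: "t (munit N i i) = t (munit N 0 0)" if i: "i < N" for i
    proof -
      have "t (munit N i 0 * munit N 0 i) = t (munit N 0 i * munit N i 0)"
        unfolding t_def using E[OF i N] E[OF N i]
        by (simp add: mult mat_trace_commute closed)
      then show ?thesis using munit_mult[OF N] munit_mult[OF i] by simp
    qed
    obtain m :: nat where m: "t (munit N 0 0) = of_nat m"
      using t_proj[OF E[OF N N] is_adj_munit[OF N N]] munit_mult[OF N] by auto
    have "of_nat K = t (\<Sum>i<N. munit N i i)" using K(1) munit_sum[OF N] by simp
    also have "\<dots> = (\<Sum>i<N. t (munit N i i))" by (rule t_sum) (simp add: E)
    also have "\<dots> = of_nat N * of_nat m" using same m by simp
    finally have "K = N * m" by (simp only: of_nat_eq_iff of_nat_mult[symmetric])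
    then show False using KN K0 by (cases m) auto
  qed
  then have k1: "k 1 = 0\<^sub>m d d" using K by simp
  have "k S = k (1 * S)" by simp
  also have "\<dots> = k 1 * k S" by (rule mult[OF U.one_mem S])
  also have "\<dots> = 0\<^sub>m d d" using k1 closed[OF S] by simp
  finally show ?thesis .
qed

section \<open>Transport to an arbitrary universe\<close>

lemma (in operator_star_algebra) eq_if_entries_eq:
  assumes "S \<in> C" "T \<in> C" "\<And>i j. entry S i j = entry T i j" shows "S = T"
proof -
  define X where "X = S - T"
  have X: "X \<in> C" unfolding X_def by (intro diff_mem assms)
  obtain Y where Y: "is_adj X Y" using ex_adj[OF X] by blast
  have Xb: "X \<cdot>\<^sub>o cscale c (basis_vec j) = 0" for c j
  proof -
    have "X \<cdot>\<^sub>o basis_vec j = 0"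
      by (rule ell2_eqI) (use assms(3) in \<open>simp add: X_def entry_def\<close>)
    then show ?thesis
      using arg_cong[OF csc_commute[OF X, of c], of "\<lambda>R. R \<cdot>\<^sub>o basis_vec j"]
      by (auto intro: ell2_eqI)
  qed
  have "Y = 0"
  proof (intro bop_eqI ell2_eqI)
    fix f j
    define z where "z = coord (Y \<cdot>\<^sub>o f) j"
    have "inner z z = inner (X \<cdot>\<^sub>o cscale z (basis_vec j)) f"
      using Y inner_basis_vec[of z j "Y \<cdot>\<^sub>o f"] by (simp add: is_adj_def z_def)
    then have "inner z z = 0" unfolding Xb by simp
    then show "coord (Y \<cdot>\<^sub>o f) j = coord (0 \<cdot>\<^sub>o f) j" by (simp add: z_def)
  qed
  then have "X = 0" using is_adj_norm[OF Y] by simp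
  then show ?thesis by (simp add: X_def)
qed

lemma ex_inj_matrices_real: "\<exists>\<phi> :: (nat \<Rightarrow> nat \<Rightarrow> complex) \<Rightarrow> real. inj \<phi>"
proof -
  obtain \<rho> :: "real \<Rightarrow> nat set" where \<rho>: "inj \<rho>"
    using eqpoll_imp_lepoll[OF eqpoll_sym[OF nat_sets_eqpoll_reals]] by (auto simp: lepoll_def)
  obtain \<sigma> :: "nat set \<Rightarrow> real" where \<sigma>: "inj \<sigma>"
    using eqpoll_imp_lepoll[OF nat_sets_eqpoll_reals] by (auto simp: lepoll_def)
  define code where "code e = to_nat ` ({(i, j, True, n) | i j n. n \<in> \<rho> (Re (e i j))} \<union>
    {(i, j, False, n) | i j n. n \<in> \<rho> (Im (e i j))})" for e :: "nat \<Rightarrow> nat \<Rightarrow> complex"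
  have "inj code"
  proof (rule injI)
    fix e e' assume "code e = code e'"
    then have "{(i, j, True, n) | i j n. n \<in> \<rho> (Re (e i j))} \<union> {(i, j, False, n) | i j n. n \<in> \<rho> (Im (e i j))}
      = {(i, j, True, n) | i j n. n \<in> \<rho> (Re (e' i j))} \<union> {(i, j, False, n) | i j n. n \<in> \<rho> (Im (e' i j))}"
      unfolding code_def by (simp only: inj_image_eq_iff[OF inj_to_nat])
    then have "\<rho> (Re (e i j)) = \<rho> (Re (e' i j))" "\<rho> (Im (e i j)) = \<rho> (Im (e' i j))" for i j
      by (auto simp: set_eq_iff)
    from injD[OF \<rho> this(1)] injD[OF \<rho> this(2)]
    show "e = e'" by (intro ext complex_eqI)
  qed
  then have "inj (\<sigma> \<circ> code)" using \<sigma> by (intro inj_compose)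
  then show ?thesis by blast
qed

lemma (in operator_star_algebra) ex_inj_on_universe:
  assumes "\<exists>f :: real \<Rightarrow> 'u. inj f" obtains g :: "bop \<Rightarrow> 'u" where "inj_on g C"
proof -
  obtain f :: "real \<Rightarrow> 'u" and \<phi> :: "(nat \<Rightarrow> nat \<Rightarrow> complex) \<Rightarrow> real" where "inj f" "inj \<phi>"
    using assms ex_inj_matrices_real by blast
  then have "inj_on (\<lambda>S. f (\<phi> (entry S))) C"
    by (intro inj_onI eq_if_entries_eq) (auto dest!: injD)
  then show ?thesis using that by blast
qed

definition transport :: "bop set \<Rightarrow> (bop \<Rightarrow> 'u) \<Rightarrow> 'u cstar_algebra" where
  "transport C g = (let r = inv_into C g in
    \<lparr>carrier = g ` C, monoid.mult = (\<lambda>x y. g (r x * r y)), one = g 1, zero = g 0,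
     add = (\<lambda>x y. g (r x + r y)), module.smult = (\<lambda>c x. g (csc c * r x)),
     star = (\<lambda>x. g (adjoint (r x))), alg_norm = (\<lambda>x. norm (r x))\<rparr>)"

locale transported = operator_star_algebra C for C +
  fixes g :: "bop \<Rightarrow> 'u"
  assumes inj: "inj_on g C" and closed: "closed C"
begin

abbreviation A :: "'u cstar_algebra" where "A \<equiv> transport C g"

lemma inv_g [simp]: "S \<in> C \<Longrightarrow> inv_into C g (g S) = S"
  using inj by simp

lemma A_simps [simp]:
  "carrier A = g ` C" "\<one>\<^bsub>A\<^esub> = g 1" "\<zero>\<^bsub>A\<^esub> = g 0"
  "S \<in> C \<Longrightarrow> T \<in> C \<Longrightarrow> g S \<otimes>\<^bsub>A\<^esub> g T = g (S * T)"
  "S \<in> C \<Longrightarrow> T \<in> C \<Longrightarrow> g S \<oplus>\<^bsub>A\<^esub> g T = g (S + T)"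
  "S \<in> C \<Longrightarrow> c \<odot>\<^bsub>A\<^esub> g S = g (csc c * S)"
  "S \<in> C \<Longrightarrow> star A (g S) = g (adjoint S)"
  "S \<in> C \<Longrightarrow> alg_norm A (g S) = norm S"
  by (simp_all add: transport_def Let_def)

lemmas mem = one_mem zero_mem add_mem mult_mem csc_mem adjoint_mem uminus_mem diff_mem

lemma abelian_group_A: "abelian_group A"
proof (rule abelian_groupI)
  fix x assume "x \<in> carrier A"
  then obtain S where S: "S \<in> C" "x = g S" by auto
  then show "\<exists>y\<in>carrier A. y \<oplus>\<^bsub>A\<^esub> x = \<zero>\<^bsub>A\<^esub>"
    by (intro bexI[of _ "g (- S)"]) (auto simp: mem)
qed (auto simp: mem algebra_simps)

lemma ring_A: "ring A"
proof (rule ringI[OF abelian_group_A])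
  show "Group.monoid A" by (rule monoidI) (auto simp: mem mult.assoc)
qed (auto simp: mem algebra_simps)

lemma minus_A: assumes "S \<in> C" "T \<in> C" shows "g S \<ominus>\<^bsub>A\<^esub> g T = g (S - T)"
proof -
  interpret abelian_group A by (rule abelian_group_A)
  have "\<ominus>\<^bsub>A\<^esub> g T = g (- T)"
    by (rule minus_equality) (use assms in \<open>auto simp: mem\<close>)
  then show ?thesis using assms by (simp add: a_minus_def mem)
qed

lemma unital_cstar_algebra_A: "unital_cstar_algebra A"
proof (intro unital_cstar_algebra.intro unital_cstar_algebra_axioms.intro ring_A)
  show "Module.module (class_ring :: complex ring) A"
  proof (rule moduleI[OF _ abelian_group_A])
    show "cring (class_ring :: complex ring)" by (rule class_cring.is_cring)
  qed (auto simp: mem csc_add[symmetric] csc_mult[symmetric] distrib_left distrib_right mult.assoc)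
  show "\<one>\<^bsub>A\<^esub> \<noteq> \<zero>\<^bsub>A\<^esub>" using inj_on_eq_iff[OF inj one_mem zero_mem] by simp
  show "norm_complete A"
    unfolding norm_complete_def
  proof (intro allI impI)
    fix X :: "nat \<Rightarrow> 'u"
    assume X: "range X \<subseteq> carrier A"
      and cau: "\<forall>e>0. \<exists>N. \<forall>m\<ge>N. \<forall>n\<ge>N. alg_norm A (X m \<ominus>\<^bsub>A\<^esub> X n) < e"
    define Y where "Y n = inv_into C g (X n)" for n
    have Y: "Y n \<in> C" "X n = g (Y n)" for n
      using X by (auto simp: Y_def inv_into_into f_inv_into_f image_subset_iff)
    have "Cauchy Y"
      using cau by (simp add: Cauchy_def dist_norm Y minus_A mem)
    then obtain L where L: "Y \<longlonglongrightarrow> L" by (auto simp: Cauchy_convergent_iff convergent_def)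
    have LC: "L \<in> C" using closed_sequentially[OF closed _ L] Y by blast
    have "(\<lambda>n. alg_norm A (X n \<ominus>\<^bsub>A\<^esub> g L)) \<longlonglongrightarrow> 0"
      using L LC by (simp add: Y minus_A mem LIM_zero tendsto_norm_zero)
    then show "\<exists>x\<in>carrier A. (\<lambda>n. alg_norm A (X n \<ominus>\<^bsub>A\<^esub> x)) \<longlonglongrightarrow> 0" using LC by auto
  qed
  fix x y c assume "x \<in> carrier A"
  then obtain S where S: "S \<in> C" "x = g S" by auto
  note adS = is_adj_adjoint[OF S(1)]
  show "star A x \<in> carrier A" using S by (simp add: mem)
  show "star A (star A x) = x"
    using S adjoint_eq[OF is_adj_sym[OF adS]] by (simp add: mem)
  show "star A (c \<odot>\<^bsub>A\<^esub> x) = cnj c \<odot>\<^bsub>A\<^esub> star A x"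
    using S adjoint_eq[OF is_adj_mult[OF is_adj_csc[of c] adS]] csc_commute[OF adjoint_mem[OF S(1)]]
    by (simp add: mem)
  show "0 \<le> alg_norm A x" using S by simp
  show "alg_norm A x = 0 \<longleftrightarrow> x = \<zero>\<^bsub>A\<^esub>"
    using S inj_on_eq_iff[OF inj S(1) zero_mem] by simp
  show "alg_norm A (c \<odot>\<^bsub>A\<^esub> x) = cmod c * alg_norm A x"
    using S by (simp add: mem norm_csc_mult)
  show "alg_norm A (star A x \<otimes>\<^bsub>A\<^esub> x) = (alg_norm A x)\<^sup>2"
    using S is_adj_cstar[OF adS] by (simp add: mem)
  assume "y \<in> carrier A"
  then obtain T where T: "T \<in> C" "y = g T" by auto
  note adT = is_adj_adjoint[OF T(1)]
  show "(c \<odot>\<^bsub>A\<^esub> x) \<otimes>\<^bsub>A\<^esub> y = c \<odot>\<^bsub>A\<^esub> (x \<otimes>\<^bsub>A\<^esub> y)"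
    using S T by (simp add: mem mult.assoc)
  have "S * (csc c * T) = csc c * (S * T)"
    using csc_commute[OF S(1), of c] by (simp add: mult.assoc[symmetric])
  then show "x \<otimes>\<^bsub>A\<^esub> (c \<odot>\<^bsub>A\<^esub> y) = c \<odot>\<^bsub>A\<^esub> (x \<otimes>\<^bsub>A\<^esub> y)"
    using S T by (simp add: mem)
  show "star A (x \<oplus>\<^bsub>A\<^esub> y) = star A x \<oplus>\<^bsub>A\<^esub> star A y"
    using S T adjoint_eq[OF is_adj_add[OF adS adT]] by (simp add: mem)
  show "star A (x \<otimes>\<^bsub>A\<^esub> y) = star A y \<otimes>\<^bsub>A\<^esub> star A x"
    using S T adjoint_eq[OF is_adj_mult[OF adS adT]] by (simp add: mem)
  show "alg_norm A (x \<oplus>\<^bsub>A\<^esub> y) \<le> alg_norm A x + alg_norm A y"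
    using S T by (simp add: mem norm_triangle_ineq)
  show "alg_norm A (x \<otimes>\<^bsub>A\<^esub> y) \<le> alg_norm A x * alg_norm A y"
    using S T by (simp add: mem norm_mult_ineq)
qed

lemma self_adjoint_A: "S \<in> C \<Longrightarrow> self_adjoint A (g S) \<longleftrightarrow> is_adj S S"
  using inj_on_eq_iff[OF inj adjoint_mem] is_adj_adjoint adjoint_eq
  by (auto simp: self_adjoint_def) metis

end

lemma real_rank_zero_uhf:
  assumes "0 < p" "inj_on g (uhf p)" shows "real_rank_zero (transport (uhf p) g)"
proof -
  interpret transported "uhf p" g
    by (intro transported.intro operator_star_algebra_uhf transported_axioms.intro assms closed_uhf)
  show ?thesis
    unfolding real_rank_zero_def
  proof (intro allI impI)
    fix x and e :: real assume x: "self_adjoint A x" and e: "0 < e"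
    then obtain S where S: "S \<in> uhf p" "x = g S" by (auto simp: self_adjoint_def)
    have "is_adj S S" using x self_adjoint_A[OF S(1)] S(2) by simp
    then obtain T V where T: "T \<in> uhf p" "is_adj T T" "V \<in> uhf p" "T * V = 1" "V * T = 1" "norm (S - T) < e"
      using uhf_real_rank_zero[OF assms(1) S(1) _ e] by blast
    have "self_adjoint A (g T)" using self_adjoint_A[OF T(1)] T(2) by simp
    moreover have "g T \<in> Units A"
      using T unfolding Units_def by (auto intro!: exI[of _ V] simp: Bex_def)
    moreover have "alg_norm A (x \<ominus>\<^bsub>A\<^esub> g T) < e"
      using T S by (simp add: minus_A mem)
    ultimately show "\<exists>y. self_adjoint A y \<and> y \<in> Units A \<and> alg_norm A (x \<ominus>\<^bsub>A\<^esub> y) < e" by blast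
  qed
qed

lemma no_findim_rep_uhf:
  assumes "1 < p" "inj_on g (uhf p)" shows "\<not> has_nonzero_findim_rep (transport (uhf p) g)"
proof -
  have "0 < p" using assms(1) by simp
  then interpret transported "uhf p" g
    by (intro transported.intro operator_star_algebra_uhf transported_axioms.intro assms closed_uhf)
  have "h x = 0\<^sub>m d d" if h: "h \<in> star_hom A (mat_star_algebra d)" and x: "x \<in> carrier A" for h d x
  proof -
    from x obtain S where S: "S \<in> uhf p" "x = g S" by auto
    define k where "k S = h (g S)" for S
    have "k S = 0\<^sub>m d d"
    proof (rule uhf_no_findim_rep[OF assms(1) _ _ _ _ S(1)])
      fix S T assume S: "S \<in> uhf p"
      then show "k S \<in> carrier_mat d d"
        using h by (auto simp: k_def star_hom_def mat_star_algebra_def)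
      show "k T = mat_adjoint (k S)" if "is_adj S T"
        using h S adjoint_eq[OF that] unfolding star_hom_def
        by (force simp: k_def mat_star_algebra_def)
      assume T: "T \<in> uhf p"
      have "h (g S \<oplus>\<^bsub>A\<^esub> g T) = h (g S) + h (g T)" "h (g S \<otimes>\<^bsub>A\<^esub> g T) = h (g S) * h (g T)"
        using h S T unfolding star_hom_def by (auto simp: mat_star_algebra_def simp del: A_simps(4,5))
      then show "k (S + T) = k S + k T" "k (S * T) = k S * k T"
        using S T by (simp_all add: k_def)
    qed
    then show ?thesis by (simp add: k_def S)
  qed
  then show ?thesis unfolding has_nonzero_findim_rep_def by blast
qed

section \<open>Relations between numbers with coprime denominators\<close>

lemma ex_linear_relation:
  fixes c :: "'i \<Rightarrow> 'b \<Rightarrow> real"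
  assumes "finite F" "finite P" "card F < card P"
  shows "\<exists>a :: 'i \<Rightarrow> real. (\<exists>p\<in>P. a p \<noteq> 0) \<and> (\<forall>s\<in>F. (\<Sum>p\<in>P. a p * c p s) = 0)"
  using assms
proof (induction F arbitrary: P c)
  case empty
  then have "P \<noteq> {}" by auto
  then show ?case by (intro exI[of _ "\<lambda>_. 1"]) auto
next
  case (insert s F)
  show ?case
  proof (cases "\<forall>p\<in>P. c p s = 0")
    case True
    obtain a :: "'i \<Rightarrow> real" where "\<exists>p\<in>P. a p \<noteq> 0" "\<forall>s\<in>F. (\<Sum>p\<in>P. a p * c p s) = 0"
      using insert.IH[of P c] insert.prems insert.hyps by auto
    with True show ?thesis by (intro exI[of _ a]) auto
  next
    case False
    then obtain q where q: "q \<in> P" "c q s \<noteq> 0" by blast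
    define c' where "c' p u = c p u - c p s / c q s * c q u" for p u
    have "card F < card (P - {q})" using insert.prems insert.hyps q by simp
    then obtain a :: "'i \<Rightarrow> real"
      where a: "\<exists>p\<in>P - {q}. a p \<noteq> 0" "\<forall>u\<in>F. (\<Sum>p\<in>P - {q}. a p * c' p u) = 0"
      using insert.IH[of "P - {q}" c'] insert.prems by auto
    define a' where "a' = a(q := - (\<Sum>p\<in>P - {q}. a p * c p s) / c q s)"
    have "(\<Sum>p\<in>P. a' p * c p u) = (\<Sum>p\<in>P - {q}. a p * c' p u)" for u
    proof -
      have "(\<Sum>p\<in>P. a' p * c p u) = a' q * c q u + (\<Sum>p\<in>P - {q}. a p * c p u)"
        using insert.prems q by (subst sum.remove[of P q]) (auto simp: a'_def intro!: sum.cong)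
      moreover have "(\<Sum>p\<in>P - {q}. a p * c' p u)
          = (\<Sum>p\<in>P - {q}. a p * c p u) - (\<Sum>p\<in>P - {q}. a p * c p s) / c q s * c q u"
        by (simp add: c'_def right_diff_distrib sum_subtractf sum_distrib_right sum_divide_distrib mult.assoc)
      ultimately show ?thesis by (simp add: a'_def)
    qed
    moreover have "c' p s = 0" for p using q by (simp add: c'_def)
    ultimately have "\<forall>u\<in>insert s F. (\<Sum>p\<in>P. a' p * c p u) = 0" using a(2) by simp
    moreover have "\<exists>p\<in>P. a' p \<noteq> 0" using a(1) by (auto simp: a'_def)
    ultimately show ?thesis by blast
  qed
qed

text \<open>A rational-linear functional on \<open>\<real>\<close> turns a real relation between rational vectors into a
  rational one.\<close>

lemma ex_rational_relation:
  fixes a :: "'i \<Rightarrow> real"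
  assumes "a p0 \<noteq> 0"
  obtains b :: "'i \<Rightarrow> rat" where "b p0 = 1"
    "\<And>P x. (\<Sum>p\<in>P. a p * of_rat (x p)) = 0 \<Longrightarrow> (\<Sum>p\<in>P. b p * x p) = 0"
proof -
  interpret vector_space_pair "\<lambda>(q::rat) (x::real). of_rat q * x" "(*) :: rat \<Rightarrow> rat \<Rightarrow> rat"
    by unfold_locales (auto simp: algebra_simps of_rat_add of_rat_mult)
  have "vs1.independent {a p0}" using assms by simp
  from linear_independent_extend[OF this, of "\<lambda>_. 1"] obtain \<phi>
    where \<phi>: "Vector_Spaces.linear (\<lambda>(q::rat) (x::real). of_rat q * x) (*) \<phi>" "\<phi> (a p0) = 1" by auto
  interpret l: Vector_Spaces.linear "\<lambda>(q::rat) (x::real). of_rat q * x" "(*) :: rat \<Rightarrow> rat \<Rightarrow> rat" \<phi>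
    by (rule \<phi>(1))
  show ?thesis
  proof
    show "\<phi> (a p0) = 1" by (rule \<phi>(2))
    fix P x assume "(\<Sum>p\<in>P. a p * of_rat (x p)) = 0"
    then have "\<phi> (\<Sum>p\<in>P. of_rat (x p) * a p) = 0" by (simp add: mult.commute l.zero)
    then show "(\<Sum>p\<in>P. \<phi> (a p) * x p) = 0"
      unfolding l.sum l.scale by (simp only: mult.commute)
  qed
qed

lemma ex_common_denominator:
  fixes b :: "'i \<Rightarrow> rat"
  assumes "finite P" obtains D :: int where "D \<noteq> 0" "\<And>p. p \<in> P \<Longrightarrow> of_int D * b p \<in> \<int>"
proof -
  have "\<exists>D::int. D \<noteq> 0 \<and> (\<forall>p\<in>P. of_int D * b p \<in> \<int>)"
    using assms
  proof (induction P)
    case (insert q P)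
    then obtain D :: int where D: "D \<noteq> 0" "\<forall>p\<in>P. of_int D * b p \<in> \<int>" by blast
    obtain n d where nd: "b q = Rat.Fract n d" "d > 0" by (cases "b q") auto
    have 1: "of_int d * b q = of_int n" using nd by (simp add: Rat.Fract_of_int_quotient)
    have "of_int (d * D) * b p \<in> \<int>" if "p \<in> insert q P" for p
    proof (cases "p = q")
      case True
      have "of_int (d * D) * b q = of_int D * (of_int d * b q)" by simp
      also have "\<dots> = of_int D * of_int n" by (simp only: 1)
      finally have "of_int (d * D) * b q = of_int (D * n)" by simp
      then show ?thesis unfolding True by (simp only: Ints_of_int)
    next
      case False
      then have "of_int D * b p \<in> \<int>" using D that by auto
      then have "of_int d * (of_int D * b p) \<in> \<int>" by (rule Ints_mult[OF Ints_of_int])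
      then show ?thesis by (simp add: mult.assoc)
    qed
    then show ?case using D(1) nd(2) by (intro exI[of _ "d * D"]) auto
  qed (auto intro: exI[of _ 1])
  then show ?thesis using that by blast
qed

text \<open>The denominator of the \<open>p0\<close>-term divides a power of \<open>p0\<close> and, by the relation, a product
  of powers of other primes.\<close>

lemma coprime_denominators:
  fixes m :: "nat \<Rightarrow> rat" and k n :: "nat \<Rightarrow> nat"
  assumes P: "finite P" "\<And>p. p \<in> P \<Longrightarrow> prime p" and p0: "p0 \<in> P"
    and m: "\<And>p. p \<in> P \<Longrightarrow> m p \<in> \<int>"
    and sum: "(\<Sum>p\<in>P. m p * (of_nat (k p) / of_nat (p ^ n p))) = 0"
  shows "m p0 * (of_nat (k p0) / of_nat (p0 ^ n p0)) \<in> \<int>"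
proof -
  define x where "x p = (of_nat (k p) / of_nat (p ^ n p) :: rat)" for p
  define M where "M = (\<Prod>p\<in>P - {p0}. int p ^ n p)"
  have pos: "p > 0" if "p \<in> P" for p using P(2)[OF that] prime_gt_0_nat by blast
  have clear: "of_int (int p ^ n p) * x p = of_nat (k p)" if "p \<in> P" for p
    using pos[OF that] by (simp add: x_def)
  have others: "of_int M * x p \<in> \<int>" if "p \<in> P - {p0}" for p
  proof -
    have "M = int p ^ n p * (\<Prod>q\<in>P - {p0} - {p}. int q ^ n q)"
      unfolding M_def using P(1) that by (intro prod.remove) auto
    then have "of_int M * x p = of_int (\<Prod>q\<in>P - {p0} - {p}. int q ^ n q) * (of_int (int p ^ n p) * x p)"
      by (simp add: mult.assoc mult.left_commute)
    also have "\<dots> = of_int (\<Prod>q\<in>P - {p0} - {p}. int q ^ n q) * of_nat (k p)"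
      using that by (subst clear) auto
    finally show ?thesis by (simp only: Ints_mult Ints_of_int Ints_of_nat)
  qed
  define y where "y = m p0 * x p0"
  have "y + (\<Sum>p\<in>P - {p0}. m p * x p) = 0"
    using sum P(1) p0 unfolding x_def[symmetric] y_def by (simp add: sum.remove)
  then have "of_int M * y = - (\<Sum>p\<in>P - {p0}. m p * (of_int M * x p))"
    by (simp add: eq_neg_iff_add_eq_0[symmetric] sum_distrib_left mult.left_commute)
  also have "\<dots> \<in> \<int>" by (intro Ints_minus Ints_sum Ints_mult m others) auto
  finally have My: "of_int M * y \<in> \<int>" .
  have "of_int (int p0 ^ n p0) * y = m p0 * (of_int (int p0 ^ n p0) * x p0)"
    by (simp add: y_def mult.left_commute)
  also have "\<dots> \<in> \<int>" unfolding clear[OF p0] by (intro Ints_mult m p0) auto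
  finally have py: "of_int (int p0 ^ n p0) * y \<in> \<int>" .
  have "coprime (int p0 ^ n p0) M"
    unfolding M_def
  proof (rule prod_coprime_right)
    fix q assume q: "q \<in> P - {p0}"
    have "coprime p0 q" using primes_coprime[of p0 q] P(2)[of p0] P(2)[of q] p0 q by auto
    then show "coprime (int p0 ^ n p0) (int q ^ n q)" by simp
  qed
  then obtain u v where uv: "u * (int p0 ^ n p0) + v * M = 1"
    using bezout_int[of "int p0 ^ n p0" M] by (auto simp: coprime_iff_gcd_eq_1)
  have "y = of_int (u * (int p0 ^ n p0) + v * M) * y" by (simp add: uv)
  also have "\<dots> = of_int u * (of_int (int p0 ^ n p0) * y) + of_int v * (of_int M * y)"
    by (simp add: algebra_simps)
  also have "\<dots> \<in> \<int>" by (intro Ints_add Ints_mult My py) auto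
  finally show ?thesis by (simp add: y_def x_def)
qed

lemma discrete_coordinate:
  fixes a :: "nat \<Rightarrow> real"
  assumes P: "finite P" "\<And>p. p \<in> P \<Longrightarrow> prime p" and p0: "p0 \<in> P" "a p0 \<noteq> 0"
  obtains D :: nat where "D > 0"
    "\<And>k n. (\<Sum>p\<in>P. a p * (of_nat (k p) / of_nat (p ^ n p))) = 0 \<Longrightarrow>
      \<exists>j::nat. real D * (of_nat (k p0) / of_nat (p0 ^ n p0)) = real j"
proof -
  obtain b :: "nat \<Rightarrow> rat" where b: "b p0 = 1"
    "\<And>P x. (\<Sum>p\<in>P. a p * of_rat (x p)) = 0 \<Longrightarrow> (\<Sum>p\<in>P. b p * x p) = 0"
    by (rule ex_rational_relation[where a = a and ?p0.0 = p0, OF p0(2)]) blast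
  obtain D :: int where D: "D \<noteq> 0" "\<And>p. p \<in> P \<Longrightarrow> of_int D * b p \<in> \<int>"
    using ex_common_denominator[OF P(1)] by metis
  show ?thesis
  proof
    show "nat \<bar>D\<bar> > 0" using D(1) by simp
    fix k n :: "nat \<Rightarrow> nat"
    assume s: "(\<Sum>p\<in>P. a p * (of_nat (k p) / of_nat (p ^ n p))) = 0"
    define x where "x p = (of_nat (k p) / of_nat (p ^ n p) :: rat)" for p
    have ofx: "of_rat (x p) = (of_nat (k p) / of_nat (p ^ n p) :: real)" for p
      by (simp add: x_def of_rat_divide of_rat_power)
    have "(\<Sum>p\<in>P. b p * x p) = 0" using s by (intro b(2)) (simp add: ofx)
    moreover have "(\<Sum>p\<in>P. of_int D * b p * (of_nat (k p) / of_nat (p ^ n p))) = of_int D * (\<Sum>p\<in>P. b p * x p)"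
      by (simp only: x_def mult.assoc sum_distrib_left)
    ultimately have "(\<Sum>p\<in>P. of_int D * b p * (of_nat (k p) / of_nat (p ^ n p))) = 0" by simp
    from coprime_denominators[OF P p0(1) D(2) this]
    obtain j where j: "of_int D * x p0 = of_int j" by (auto simp: b(1) x_def elim: Ints_cases)
    have "of_rat (of_int D * x p0) = (of_rat (of_int j) :: real)" by (simp only: j)
    then have rj: "of_int D * of_rat (x p0) = (of_int j :: real)" by (simp add: of_rat_mult)
    have "0 \<le> (of_rat (x p0) :: real)" unfolding ofx by simp
    then have "real (nat \<bar>D\<bar>) * of_rat (x p0) = real (nat \<bar>j\<bar>)"
      using arg_cong[OF rj, of abs] by (simp add: abs_mult)
    then show "\<exists>i::nat. real (nat \<bar>D\<bar>) * (of_nat (k p0) / of_nat (p0 ^ n p0)) = real i"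
      unfolding ofx by blast
  qed
qed

section \<open>Traces on an initial object\<close>

locale faithful_rep = operator_star_algebra C + B: unital_cstar_algebra B
  for C and B :: "('a, 'm) cstar_algebra_scheme" (structure) +
  fixes k :: "'a \<Rightarrow> bop"
  assumes k_mem: "x \<in> carrier B \<Longrightarrow> k x \<in> C"
    and k_inj: "inj_on k (carrier B)"
    and k_add: "x \<in> carrier B \<Longrightarrow> y \<in> carrier B \<Longrightarrow> k (x \<oplus> y) = k x + k y"
    and k_mult: "x \<in> carrier B \<Longrightarrow> y \<in> carrier B \<Longrightarrow> k (x \<otimes> y) = k x * k y"
    and k_smult: "x \<in> carrier B \<Longrightarrow> k (c \<odot> x) = csc c * k x"
    and k_star: "x \<in> carrier B \<Longrightarrow> is_adj (k x) (k (star B x))"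
    and k_one: "k \<one> = 1"
begin

lemma k_zero: "k \<zero> = 0"
  using k_add[of \<zero> \<zero>] by simp

lemma k_eq_iff: "x \<in> carrier B \<Longrightarrow> y \<in> carrier B \<Longrightarrow> k x = k y \<longleftrightarrow> x = y"
  using inj_on_eq_iff[OF k_inj] .

lemma projection_iff:
  "projection B x \<longleftrightarrow> x \<in> carrier B \<and> is_adj (k x) (k x) \<and> k x * k x = k x"
proof (cases "x \<in> carrier B")
  case True
  have "star B x = x \<longleftrightarrow> is_adj (k x) (k x)"
    using k_eq_iff[OF B.star_closed[OF True] True] k_star[OF True] is_adj_unique by metis
  moreover have "x \<otimes> x = x \<longleftrightarrow> k x * k x = k x"
    using k_eq_iff[of "x \<otimes> x" x] k_mult[OF True True] True by auto
  ultimately show ?thesis using True by (simp add: projection_def self_adjoint_def)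
qed (simp add: projection_def self_adjoint_def)

end

lemma embedding_faithful_rep:
  assumes "unital_cstar_algebra B" "transported C g" "embeds_unitally B (transport C g)"
  obtains k where "faithful_rep C B k"
proof -
  interpret B: unital_cstar_algebra B by fact
  interpret transported C g by fact
  obtain h where h: "h \<in> star_hom B A" "h \<one>\<^bsub>B\<^esub> = \<one>\<^bsub>A\<^esub>" "inj_on h (carrier B)"
    using assms(3) by (auto simp: embeds_unitally_def)
  define k where "k x = inv_into C g (h x)" for x
  have k: "k x \<in> C" "h x = g (k x)" if "x \<in> carrier B" for x
    using h(1) that by (auto simp: star_hom_def k_def Pi_iff inv_into_into f_inv_into_f)
  have eq: "k x = S" if "h x = g S" "S \<in> C" for x S
    using that by (simp add: k_def)
  have "faithful_rep C B k"
  proof (intro faithful_rep.intro faithful_rep_axioms.intro operator_star_algebra_axioms assms(1))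
    show "inj_on k (carrier B)"
      using inj_onD[OF h(3)] by (intro inj_onI) (metis k(2))
    show "k \<one>\<^bsub>B\<^esub> = 1" using h(2) by (intro eq) (simp_all add: one_mem)
    fix x y c assume x: "x \<in> carrier B"
    show "k x \<in> C" by (rule k(1)[OF x])
    show "k (c \<odot>\<^bsub>B\<^esub> x) = csc c * k x"
      using h(1) k[OF x] x by (intro eq csc_mem) (auto simp: star_hom_def)
    have "k (star B x) = adjoint (k x)"
      using h(1) k[OF x] x by (intro eq adjoint_mem) (auto simp: star_hom_def)
    then show "is_adj (k x) (k (star B x))" using is_adj_adjoint[OF k(1)[OF x]] by simp
    assume y: "y \<in> carrier B"
    show "k (x \<oplus>\<^bsub>B\<^esub> y) = k x + k y"
      using h(1) k[OF x] k[OF y] x y by (intro eq add_mem) (auto simp: star_hom_def)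
    show "k (x \<otimes>\<^bsub>B\<^esub> y) = k x * k y"
      using h(1) k[OF x] k[OF y] x y by (intro eq mult_mem) (auto simp: star_hom_def)
  qed
  then show ?thesis by (rule that)
qed

lemma tracial_state_of_rep:
  assumes p: "0 < p" and "faithful_rep (uhf p) B k"
  shows "restrict (\<lambda>x. uhf_tr p (k x)) (carrier B) \<in> tracial_states B"
proof -
  interpret faithful_rep "uhf p" B k by fact
  show ?thesis
    unfolding tracial_states_def
    using uhf_tr_pos[OF p k_mem k_star]
    by (auto simp: k_add k_mult k_smult k_one k_mem uhf_tr_add[OF p] uhf_tr_csc[OF p] uhf_tr_one[OF p]
        B.star_closed intro: uhf_tr_commute[OF p])
qed

lemma projection_trace_of_rep:
  assumes p: "0 < p" and "faithful_rep (uhf p) B k" and e: "projection B e"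
  obtains j n :: nat where "uhf_tr p (k e) = of_nat j / of_nat (p ^ n)" "j = 0 \<Longrightarrow> e = \<zero>\<^bsub>B\<^esub>"
proof -
  interpret faithful_rep "uhf p" B k by fact
  have e': "e \<in> carrier B" "is_adj (k e) (k e)" "k e * k e = k e" using e by (auto simp: projection_iff)
  obtain j n :: nat where jn: "uhf_tr p (k e) = of_nat j / of_nat (p ^ n)" "j = 0 \<Longrightarrow> k e = 0"
    using uhf_projection_trace[OF p k_mem[OF e'(1)] e'(2,3)] by blast
  then show ?thesis using that[of j n] k_eq_iff[OF e'(1) B.zero_closed] by (auto simp: k_zero)
qed

lemma initial_object_rep:
  assumes "\<exists>f :: real \<Rightarrow> 'u. inj f" "initial_object TYPE('u) B" "1 < p"
  obtains k where "faithful_rep (uhf p) B k"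
proof -
  have p: "0 < p" using assms(3) by simp
  interpret operator_star_algebra "uhf p" by (rule operator_star_algebra_uhf[OF p])
  obtain g :: "bop \<Rightarrow> 'u" where g: "inj_on g (uhf p)" using ex_inj_on_universe[OF assms(1)] by blast
  have t: "transported (uhf p) g"
    by (intro transported.intro transported_axioms.intro operator_star_algebra_axioms g closed_uhf)
  have "embeds_unitally B (transport (uhf p) g)"
    using assms(2) transported.unital_cstar_algebra_A[OF t] real_rank_zero_uhf[OF p g]
      no_findim_rep_uhf[OF assms(3) g]
    unfolding initial_object_def by blast
  moreover have "unital_cstar_algebra B" using assms(2) by (simp add: initial_object_def)
  ultimately show ?thesis using embedding_faithful_rep[OF _ t] that by blast
qed

text \<open>A non-zero projection of least trace is minimal.\<close>

lemma ex_minimal_projection: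
  assumes p: "0 < p" and rep: "faithful_rep (uhf p) B k" and D: "D > 0"
    and discrete: "\<And>e. projection B e \<Longrightarrow> \<exists>j::nat. of_nat D * uhf_tr p (k e) = of_nat j"
  shows "\<exists>e. minimal_nonzero_projection B e"
proof -
  interpret faithful_rep "uhf p" B k by fact
  define v where "v e = (SOME j::nat. of_nat D * uhf_tr p (k e) = of_nat j)" for e
  have v: "of_nat D * uhf_tr p (k e) = of_nat (v e)" if "projection B e" for e
    unfolding v_def using discrete[OF that] by (rule someI_ex)
  have v0: "v e > 0" if e: "projection B e" "e \<noteq> \<zero>\<^bsub>B\<^esub>" for e
  proof -
    obtain j n :: nat where jn: "uhf_tr p (k e) = of_nat j / of_nat (p ^ n)" "j = 0 \<Longrightarrow> e = \<zero>\<^bsub>B\<^esub>"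
      using projection_trace_of_rep[OF p rep e(1)] by blast
    then have "uhf_tr p (k e) \<noteq> 0" using e(2) p by auto
    then have "(of_nat (v e) :: complex) \<noteq> 0" using D by (simp add: v[OF e(1), symmetric])
    then show ?thesis by simp
  qed
  let ?P = "\<lambda>e. projection B e \<and> e \<noteq> \<zero>\<^bsub>B\<^esub>"
  have "?P \<one>\<^bsub>B\<^esub>" using B.one_neq_zero by (simp add: projection_iff k_one is_adj_one)
  then obtain e where e: "?P e" "\<And>q. ?P q \<Longrightarrow> v e \<le> v q"
    using ex_has_least_nat[of ?P "\<one>\<^bsub>B\<^esub>" v] by blast
  have "\<not> (\<exists>q. subprojection B q e \<and> q \<noteq> \<zero>\<^bsub>B\<^esub> \<and> q \<noteq> e)"
  proof
    assume "\<exists>q. subprojection B q e \<and> q \<noteq> \<zero>\<^bsub>B\<^esub> \<and> q \<noteq> e"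
    then obtain q where q: "projection B q" "e \<otimes>\<^bsub>B\<^esub> q = q" "q \<otimes>\<^bsub>B\<^esub> e = q" "q \<noteq> \<zero>\<^bsub>B\<^esub>" "q \<noteq> e"
      by (auto simp: subprojection_def)
    have c: "e \<in> carrier B" "q \<in> carrier B" using e(1) q(1) by (auto simp: projection_iff)
    have eq: "k e * k q = k q" "k q * k e = k q"
      using k_mult[OF c] k_mult[OF c(2,1)] q(2,3) by auto
    define d where "d = e \<oplus>\<^bsub>B\<^esub> ((- 1) \<odot>\<^bsub>B\<^esub> q)"
    have dc: "d \<in> carrier B" unfolding d_def using c by simp
    have kd: "k d = k e - k q"
      unfolding d_def using c csc_of_real[of "- 1"] by (simp add: k_add k_smult)
    have "projection B d"
      using e(1) q(1) eq dc
      by (auto simp: projection_iff kd right_diff_distrib left_diff_distrib intro: is_adj_diff)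
    moreover have "d \<noteq> \<zero>\<^bsub>B\<^esub>"
      using k_eq_iff[OF dc B.zero_closed] k_eq_iff[OF c] q(5) by (simp add: kd k_zero)
    ultimately have "0 < v d" by (rule v0)
    have "(of_nat (v d) :: complex) = of_nat D * (uhf_tr p (k e) - uhf_tr p (k q))"
      using v[OF \<open>projection B d\<close>] uhf_tr_diff[OF p k_mem[OF c(1)] k_mem[OF c(2)]] by (simp add: kd)
    also have "\<dots> = of_nat (v e) - of_nat (v q)"
      using v[OF q(1)] v[of e] e(1) by (simp add: right_diff_distrib)
    finally have "(of_nat (v e) :: complex) = of_nat (v q + v d)" by simp
    then have "v e = v q + v d" by (simp only: of_nat_eq_iff)
    then show False using e(2)[of q] q(1,4) \<open>0 < v d\<close> by simp
  qed
  then show ?thesis using e(1) by (auto simp: minimal_nonzero_projection_def)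
qed

lemma (in unital_cstar_algebra) closed_ideal_zero: "closed_ideal {\<zero>} A"
  unfolding closed_ideal_def
proof (intro conjI allI ballI impI)
  show "ideal {\<zero>} A" by (rule ring.zeroideal[OF unital_cstar_algebra.axioms(1)[OF unital_cstar_algebra_axioms]])
  fix X :: "nat \<Rightarrow> 'a" and x
  assume x: "x \<in> carrier A" and X: "range X \<subseteq> {\<zero>}" "(\<lambda>n. alg_norm A (X n \<ominus> x)) \<longlonglongrightarrow> 0"
  have "X n = \<zero>" for n using X(1) by auto
  then have "alg_norm A (\<zero> \<ominus> x) = 0" using X(2) by (simp add: LIMSEQ_const_iff)
  moreover have "\<zero> \<ominus> x \<in> carrier A" using x by simp
  ultimately have "\<zero> \<ominus> x = \<zero>" using norm_eq_zero_iff by blast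
  then show "x \<in> {\<zero>}" using x by simp
qed

lemma (in unital_cstar_algebra) minimal_projection_quotient_zero:
  assumes "minimal_nonzero_projection A e"
  shows "minimal_nonzero_projection (quotient_cstar A {\<zero>}) {e}"
proof -
  let ?Q = "quotient_cstar A {\<zero>}"
  have coset: "{\<zero>} +> x = {x}" if "x \<in> carrier A" for x
    using that by (simp add: a_r_coset_def')
  have carr: "X \<in> carrier ?Q \<longleftrightarrow> (\<exists>x\<in>carrier A. X = {x})" for X
    by (auto simp: quotient_cstar_def FactRing_def A_RCOSETS_def' coset)
  have st: "star ?Q {x} = {star A x}" if "x \<in> carrier A" for x
    using that by (simp add: quotient_cstar_def coset star_closed)
  have mu: "{x} \<otimes>\<^bsub>?Q\<^esub> {y} = {x \<otimes> y}" if "x \<in> carrier A" "y \<in> carrier A" for x y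
    using that by (simp add: quotient_cstar_def FactRing_def rcoset_mult_def coset)
  have z: "\<zero>\<^bsub>?Q\<^esub> = {\<zero>}"
    by (simp add: quotient_cstar_def FactRing_def)
  have proj: "projection ?Q X \<longleftrightarrow> (\<exists>x. X = {x} \<and> projection A x)" for X
    by (auto simp: projection_def self_adjoint_def carr st mu)
  have e: "projection A e" "e \<noteq> \<zero>" "e \<in> carrier A"
    using assms by (auto simp: minimal_nonzero_projection_def projection_def self_adjoint_def)
  show ?thesis
    unfolding minimal_nonzero_projection_def
  proof (intro conjI notI)
    show "projection ?Q {e}" using e by (simp add: proj)
    show False if "{e} = \<zero>\<^bsub>?Q\<^esub>" using that e by (simp add: z)
    assume "\<exists>X. subprojection ?Q X {e} \<and> X \<noteq> \<zero>\<^bsub>?Q\<^esub> \<and> X \<noteq> {e}"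
    then obtain X where X: "subprojection ?Q X {e}" "X \<noteq> \<zero>\<^bsub>?Q\<^esub>" "X \<noteq> {e}" by blast
    then obtain q where q: "X = {q}" "projection A q" by (auto simp: subprojection_def proj)
    have "q \<in> carrier A" using q(2) by (simp add: projection_def self_adjoint_def)
    then have "subprojection A q e" using X(1) q e by (simp add: subprojection_def mu)
    then show False using assms X(2,3) q(1) by (auto simp: minimal_nonzero_projection_def z)
  qed
qed

theorem proposition5p3:
  fixes B :: "'a cstar_algebra"
  assumes universe_large: "\<exists>f :: real \<Rightarrow> 'u. inj f"
    and initial: "initial_object TYPE('u) B"
    and no_minimal: "\<And>I. closed_ideal I B \<Longrightarrow> \<not> (\<exists>p. minimal_nonzero_projection (quotient_cstar B I) p)"
  shows "infinite_dimensional (tracial_states B)"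
  unfolding infinite_dimensional_def
proof
  assume "\<exists>F. finite F \<and> tracial_states B \<subseteq> finite_affine_hull F"
  then obtain F where F: "finite F" "tracial_states B \<subseteq> finite_affine_hull F" by blast
  interpret B: unital_cstar_algebra B using initial by (simp add: initial_object_def)
  obtain P :: "nat set" where P: "finite P" "card P = Suc (card F)" "P \<subseteq> {p. prime p}"
    using infinite_arbitrarily_large[OF primes_infinite] by blast
  have prime: "prime p" if "p \<in> P" for p using P(3) that by blast
  have "\<forall>p\<in>P. \<exists>k. faithful_rep (uhf p) B k"
    using initial_object_rep[OF universe_large initial] prime prime_gt_1_nat by metis
  then obtain k where k: "\<And>p. p \<in> P \<Longrightarrow> faithful_rep (uhf p) B (k p)" by metis
  have pos: "0 < p" if "p \<in> P" for p using prime_gt_0_nat[OF prime[OF that]] .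
  define t where "t p = restrict (\<lambda>x. uhf_tr p (k p x)) (carrier B)" for p
  have "t p \<in> finite_affine_hull F" if "p \<in> P" for p
    using tracial_state_of_rep[OF pos[OF that] k[OF that]] F(2) by (auto simp: t_def)
  then have "\<forall>p\<in>P. \<exists>c :: ('a \<Rightarrow> complex) \<Rightarrow> real. t p = (\<lambda>x. \<Sum>s\<in>F. complex_of_real (c s) * s x)"
    unfolding finite_affine_hull_def by blast
  then obtain c :: "nat \<Rightarrow> ('a \<Rightarrow> complex) \<Rightarrow> real"
    where c: "\<And>p. p \<in> P \<Longrightarrow> t p = (\<lambda>x. \<Sum>s\<in>F. complex_of_real (c p s) * s x)" by metis
  obtain a p0 where a: "p0 \<in> P" "a p0 \<noteq> 0" "\<And>s. s \<in> F \<Longrightarrow> (\<Sum>p\<in>P. a p * c p s) = 0"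
    using ex_linear_relation[OF F(1) P(1), of c] P(2) by auto
  have relation: "(\<Sum>p\<in>P. complex_of_real (a p) * t p x) = 0" for x
  proof -
    have "(\<Sum>p\<in>P. complex_of_real (a p) * t p x)
        = (\<Sum>p\<in>P. \<Sum>s\<in>F. complex_of_real (a p * c p s) * s x)"
      by (intro sum.cong refl) (simp add: c sum_distrib_left mult.assoc)
    also have "\<dots> = (\<Sum>s\<in>F. complex_of_real (\<Sum>p\<in>P. a p * c p s) * s x)"
      by (subst sum.swap) (simp add: sum_distrib_right)
    also have "\<dots> = 0" using a(3) by simp
    finally show ?thesis .
  qed
  obtain D :: nat where D: "D > 0"
    "\<And>j n. (\<Sum>p\<in>P. a p * (of_nat (j p) / of_nat (p ^ n p))) = 0 \<Longrightarrow>
      \<exists>i::nat. real D * (of_nat (j p0) / of_nat (p0 ^ n p0)) = real i"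
    using discrete_coordinate[OF P(1) prime a(1), of a] a(2) by blast
  have "\<exists>i::nat. of_nat D * uhf_tr p0 (k p0 e) = of_nat i" if e: "projection B e" for e
  proof -
    have ec: "e \<in> carrier B" using e by (simp add: projection_def self_adjoint_def)
    have "\<forall>p\<in>P. \<exists>j n::nat. uhf_tr p (k p e) = of_nat j / of_nat (p ^ n)"
      using projection_trace_of_rep[OF pos k e] by metis
    then obtain j n :: "nat \<Rightarrow> nat"
      where jn: "\<And>p. p \<in> P \<Longrightarrow> uhf_tr p (k p e) = of_nat (j p) / of_nat (p ^ n p)" by metis
    have tr: "uhf_tr p (k p e) = complex_of_real (of_nat (j p) / of_nat (p ^ n p))" if "p \<in> P" for p
      using jn[OF that] by simp
    have "complex_of_real (\<Sum>p\<in>P. a p * (of_nat (j p) / of_nat (p ^ n p)))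
        = (\<Sum>p\<in>P. complex_of_real (a p) * t p e)"
      unfolding of_real_sum of_real_mult using ec by (intro sum.cong refl) (simp only: t_def restrict_apply if_True tr)
    then have "complex_of_real (\<Sum>p\<in>P. a p * (of_nat (j p) / of_nat (p ^ n p))) = 0"
      by (simp only: relation)
    then have "(\<Sum>p\<in>P. a p * (of_nat (j p) / of_nat (p ^ n p))) = 0"
      by (simp only: of_real_eq_0_iff)
    from D(2)[OF this] obtain i :: nat
      where i: "real D * (of_nat (j p0) / of_nat (p0 ^ n p0)) = real i" by blast
    have "of_nat D * uhf_tr p0 (k p0 e) = complex_of_real (real D * (of_nat (j p0) / of_nat (p0 ^ n p0)))"
      by (simp add: tr[OF a(1)])
    then show ?thesis unfolding i by auto
  qed
  from ex_minimal_projection[OF pos[OF a(1)] k[OF a(1)] D(1) this]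
  obtain e where "minimal_nonzero_projection B e" by blast
  then show False
    using B.minimal_projection_quotient_zero no_minimal[OF B.closed_ideal_zero] by blast
qed

end
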